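(* Suppose $(G_i,c_i)$, $i\in I$, are circularly-ordered groups, each equipped with a convex subgroup $H_i\subset G_i$ and an order-preserving isomorphism $\phi_i:(H,d)\to(H_i,c_i)$ from a circularly-ordered group $(H,d)$ (where $H_i$ carries the restriction of $c_i$). Then the free product with amalgamation $*_{i\in I}G_i\,(H_i\stackrel{\phi_i}{\cong}H)$ admits a circular ordering $c$ which extends the ordering $c_i$ of $G_i$ for each $i\in I$.
   Context: A circular ordering of a group $G$ is a function $c:G^3\to\{0,\pm1\}$ such that: $c(a_1,a_2,a_3)=0$ if and only if $a_i=a_j$ for some $i\ne j$; $c(a_2,a_3,a_4)-c(a_1,a_3,a_4)+c(a_1,a_2,a_4)-c(a_1,a_2,a_3)=0$ for all $a_1,\dots,a_4\in G$; and $c(ga_1,ga_2,ga_3)=c(a_1,a_2,a_3)$ for all $g,a_1,a_2,a_3\in G$. A pair $(G,c)$ is a circularly-ordered group. A homomorphism $\phi:(G,c)\to(H,d)$ is order-preserving if $c(g_1,g_2,g_3)=d(\phi(g_1),\phi(g_2),\phi(g_3))$ for all $g_1,g_2,g_3\in G$. A proper subgroup $H$ of a circularly-ordered group $(G,c)$ is convex (with respect to $c$) if for every $g\in G\setminus H$, $f\in G$ and $h_1,h_2\in H$: whenever $c(h_1,g,h_2)=1$ and $c(h_2,f,h_1)=1$, then $f\in H$. $*_{i\in I}G_i\,(H_i\stackrel{\phi_i}{\cong}H)$ denotes the free product of the $G_i$ amalgamated by identifying $\phi_i(h)$ with $\phi_j(h)$ for all $h\in H$, $i,j\in I$. Each $G_i$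 is regarded as a subgroup of it, and an ordering of the amalgam extends $c_i$ if it restricts to $c_i$ on $G_i$. *)

theory Defs
  imports "HOL-Algebra.Algebra"
begin

section \<open>Circular orderings of groups\<close>

text \<open>
  A circular ordering is an integer-valued function whose behaviour matters only on the carrier.
\<close>

definition circular_ordering ::
  "('a, 'm) monoid_scheme \<Rightarrow> ('a \<Rightarrow> 'a \<Rightarrow> 'a \<Rightarrow> int) \<Rightarrow> bool" where
  "circular_ordering G c \<longleftrightarrow>
     (\<forall>a1\<in>carrier G. \<forall>a2\<in>carrier G. \<forall>a3\<in>carrier G. c a1 a2 a3 \<in> {-1, 0, 1}) \<and>
     (\<forall>a1\<in>carrier G. \<forall>a2\<in>carrier G. \<forall>a3\<in>carrier G.
        c a1 a2 a3 = 0 \<longleftrightarrow> (a1 = a2 \<or> a1 = a3 \<or> a2 = a3)) \<and>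
     (\<forall>a1\<in>carrier G. \<forall>a2\<in>carrier G. \<forall>a3\<in>carrier G. \<forall>a4\<in>carrier G.
        c a2 a3 a4 - c a1 a3 a4 + c a1 a2 a4 - c a1 a2 a3 = 0) \<and>
     (\<forall>g\<in>carrier G. \<forall>a1\<in>carrier G. \<forall>a2\<in>carrier G. \<forall>a3\<in>carrier G.
        c (g \<otimes>\<^bsub>G\<^esub> a1) (g \<otimes>\<^bsub>G\<^esub> a2) (g \<otimes>\<^bsub>G\<^esub> a3) = c a1 a2 a3)"

definition circularly_ordered_group ::
  "('a, 'm) monoid_scheme \<Rightarrow> ('a \<Rightarrow> 'a \<Rightarrow> 'a \<Rightarrow> int) \<Rightarrow> bool" where
  "circularly_ordered_group G c \<longleftrightarrow> group G \<and> circular_ordering G c"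

definition order_preserving ::
  "('a, 'm) monoid_scheme \<Rightarrow> ('a \<Rightarrow> 'a \<Rightarrow> 'a \<Rightarrow> int) \<Rightarrow> ('b \<Rightarrow> 'b \<Rightarrow> 'b \<Rightarrow> int) \<Rightarrow>
   ('a \<Rightarrow> 'b) \<Rightarrow> bool" where
  "order_preserving G c d \<phi> \<longleftrightarrow>
     (\<forall>g1\<in>carrier G. \<forall>g2\<in>carrier G. \<forall>g3\<in>carrier G. c g1 g2 g3 = d (\<phi> g1) (\<phi> g2) (\<phi> g3))"

definition convex_subgroup ::
  "'a set \<Rightarrow> ('a, 'm) monoid_scheme \<Rightarrow> ('a \<Rightarrow> 'a \<Rightarrow> 'a \<Rightarrow> int) \<Rightarrow> bool" where
  "convex_subgroup H G c \<longleftrightarrow>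
     subgroup H G \<and> H \<noteq> carrier G \<and>
     (\<forall>g\<in>carrier G - H. \<forall>f\<in>carrier G. \<forall>h1\<in>H. \<forall>h2\<in>H.
        c h1 g h2 = 1 \<and> c h2 f h1 = 1 \<longrightarrow> f \<in> H)"

section \<open>Free products with amalgamation\<close>

text \<open>
  The amalgam is given by its standard presentation: words in the disjoint union of the groups
  \<open>G i\<close>, where a letter \<open>(i, x)\<close> stands for \<open>x \<in> G i\<close>, modulo the congruence generated by the
  multiplication tables of the \<open>G i\<close> and the identifications of \<open>\<phi> i h\<close> with \<open>\<phi> j h\<close>.
\<close>

definition amalgam_words :: "'i set \<Rightarrow> ('i \<Rightarrow> ('a, 'm) monoid_scheme) \<Rightarrow> ('i \<times> 'a) list set" where
  "amalgam_words I G = lists (SIGMA i:I. carrier (G i))"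

inductive amalgam_eq ::
  "'i set \<Rightarrow> ('i \<Rightarrow> ('a, 'm) monoid_scheme) \<Rightarrow> ('h, 'n) monoid_scheme \<Rightarrow> ('i \<Rightarrow> 'h \<Rightarrow> 'a) \<Rightarrow>
   ('i \<times> 'a) list \<Rightarrow> ('i \<times> 'a) list \<Rightarrow> bool"
  for I G H \<phi> where
  refl: "u \<in> amalgam_words I G \<Longrightarrow> amalgam_eq I G H \<phi> u u"
| sym: "amalgam_eq I G H \<phi> u v \<Longrightarrow> amalgam_eq I G H \<phi> v u"
| trans: "amalgam_eq I G H \<phi> u v \<Longrightarrow> amalgam_eq I G H \<phi> v w \<Longrightarrow> amalgam_eq I G H \<phi> u w"
| mult: "u \<in> amalgam_words I G \<Longrightarrow> v \<in> amalgam_words I G \<Longrightarrow> i \<in> I \<Longrightarrow>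
    x \<in> carrier (G i) \<Longrightarrow> y \<in> carrier (G i) \<Longrightarrow>
    amalgam_eq I G H \<phi> (u @ [(i, x), (i, y)] @ v) (u @ [(i, x \<otimes>\<^bsub>G i\<^esub> y)] @ v)"
| one: "u \<in> amalgam_words I G \<Longrightarrow> v \<in> amalgam_words I G \<Longrightarrow> i \<in> I \<Longrightarrow>
    amalgam_eq I G H \<phi> (u @ [(i, \<one>\<^bsub>G i\<^esub>)] @ v) (u @ v)"
| identify: "u \<in> amalgam_words I G \<Longrightarrow> v \<in> amalgam_words I G \<Longrightarrow> i \<in> I \<Longrightarrow> j \<in> I \<Longrightarrow>
    h \<in> carrier H \<Longrightarrow>
    amalgam_eq I G H \<phi> (u @ [(i, \<phi> i h)] @ v) (u @ [(j, \<phi> j h)] @ v)"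

definition amalgam_rel ::
  "'i set \<Rightarrow> ('i \<Rightarrow> ('a, 'm) monoid_scheme) \<Rightarrow> ('h, 'n) monoid_scheme \<Rightarrow> ('i \<Rightarrow> 'h \<Rightarrow> 'a) \<Rightarrow>
   (('i \<times> 'a) list \<times> ('i \<times> 'a) list) set" where
  "amalgam_rel I G H \<phi> = {(u, v). amalgam_eq I G H \<phi> u v}"

definition amalgam ::
  "'i set \<Rightarrow> ('i \<Rightarrow> ('a, 'm) monoid_scheme) \<Rightarrow> ('h, 'n) monoid_scheme \<Rightarrow> ('i \<Rightarrow> 'h \<Rightarrow> 'a) \<Rightarrow>
   ('i \<times> 'a) list set monoid" where
  "amalgam I G H \<phi> =
     \<lparr> carrier = amalgam_words I G // amalgam_rel I G H \<phi>,
       monoid.mult = (\<lambda>A B. \<Union>u\<in>A. \<Union>v\<in>B. amalgam_rel I G H \<phi> `` {u @ v}),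
       monoid.one = amalgam_rel I G H \<phi> `` {[]} \<rparr>"

definition amalgam_inj ::
  "'i set \<Rightarrow> ('i \<Rightarrow> ('a, 'm) monoid_scheme) \<Rightarrow> ('h, 'n) monoid_scheme \<Rightarrow> ('i \<Rightarrow> 'h \<Rightarrow> 'a) \<Rightarrow>
   'i \<Rightarrow> 'a \<Rightarrow> ('i \<times> 'a) list set" where
  "amalgam_inj I G H \<phi> i x = amalgam_rel I G H \<phi> `` {[(i, x)]}"

locale amalgam_data =
  fixes I :: "'i set"
    and G :: "'i \<Rightarrow> ('a, 'm) monoid_scheme"
    and H :: "('h, 'n) monoid_scheme"
    and \<phi> :: "'i \<Rightarrow> 'h \<Rightarrow> 'a"
  assumes group_G: "i \<in> I \<Longrightarrow> group (G i)"
    and phi_closed: "i \<in> I \<Longrightarrow> h \<in> carrier H \<Longrightarrow> \<phi> i h \<in> carrier (G i)"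
begin

abbreviation "W \<equiv> amalgam_words I G"
abbreviation "R \<equiv> amalgam_rel I G H \<phi>"
abbreviation "P \<equiv> amalgam I G H \<phi>"
abbreviation "\<iota> \<equiv> amalgam_inj I G H \<phi>"

lemma words_simps [simp]:
  "[] \<in> W"
  "p # u \<in> W \<longleftrightarrow> fst p \<in> I \<and> snd p \<in> carrier (G (fst p)) \<and> u \<in> W"
  "u @ v \<in> W \<longleftrightarrow> u \<in> W \<and> v \<in> W"
  by (cases p; auto simp: amalgam_words_def)+

lemma amalgam_eq_words: "amalgam_eq I G H \<phi> u v \<Longrightarrow> u \<in> W \<and> v \<in> W"
  by (induction rule: amalgam_eq.induct)
     (auto simp: phi_closed group.is_monoid[OF group_G] monoid.m_closed monoid.one_closed)

lemma equiv_R: "equiv W R"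
proof (rule equivI)
  show "R \<subseteq> W \<times> W" using amalgam_eq_words by (auto simp: amalgam_rel_def)
  show "refl_on W R" by (auto simp: amalgam_rel_def intro!: refl_onI amalgam_eq.refl)
  show "sym R" by (auto simp: amalgam_rel_def intro!: symI amalgam_eq.sym)
  show "trans R" by (auto simp: amalgam_rel_def intro!: transI intro: amalgam_eq.trans)
qed

lemma amalgam_eq_append_right:
  "amalgam_eq I G H \<phi> u v \<Longrightarrow> w \<in> W \<Longrightarrow> amalgam_eq I G H \<phi> (u @ w) (v @ w)"
proof (induction rule: amalgam_eq.induct)
  case (mult u v i x y)
  then show ?case using amalgam_eq.mult[of u I G "v @ w" i x y] by simp
next
  case (one u v i)
  then show ?case using amalgam_eq.one[of u I G "v @ w" i] by simp
next
  case (identify u v i j h)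
  then show ?case using amalgam_eq.identify[of u I G "v @ w" i j h] by simp
qed (auto intro: amalgam_eq.intros(1-3))

lemma amalgam_eq_append_left:
  "amalgam_eq I G H \<phi> u v \<Longrightarrow> w \<in> W \<Longrightarrow> amalgam_eq I G H \<phi> (w @ u) (w @ v)"
proof (induction rule: amalgam_eq.induct)
  case (mult u v i x y)
  then show ?case using amalgam_eq.mult[of "w @ u" I G v i x y] by simp
next
  case (one u v i)
  then show ?case using amalgam_eq.one[of "w @ u" I G v i] by simp
next
  case (identify u v i j h)
  then show ?case using amalgam_eq.identify[of "w @ u" I G v i j h] by simp
qed (auto intro: amalgam_eq.intros(1-3))

lemma congruent2_append: "congruent2 R R (\<lambda>u v. R `` {u @ v})"
proof (rule congruent2I')
  fix u u' v v' assume "(u, u') \<in> R" "(v, v') \<in> R"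
  then have "amalgam_eq I G H \<phi> u u'" "amalgam_eq I G H \<phi> v v'"
    by (auto simp: amalgam_rel_def)
  then have "amalgam_eq I G H \<phi> (u @ v) (u' @ v')"
    by (meson amalgam_eq.trans amalgam_eq_append_left amalgam_eq_append_right amalgam_eq_words)
  then show "R `` {u @ v} = R `` {u' @ v'}"
    using equiv_class_eq[OF equiv_R] by (auto simp: amalgam_rel_def)
qed

lemma carrier_P: "carrier P = W // R"
  and one_P: "\<one>\<^bsub>P\<^esub> = R `` {[]}"
  by (simp_all add: amalgam_def)

lemma mult_P: "u \<in> W \<Longrightarrow> v \<in> W \<Longrightarrow> R `` {u} \<otimes>\<^bsub>P\<^esub> R `` {v} = R `` {u @ v}"
  using UN_equiv_class2[OF equiv_R equiv_R congruent2_append] by (simp add: amalgam_def)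

lemma class_eqI: "amalgam_eq I G H \<phi> u v \<Longrightarrow> R `` {u} = R `` {v}"
  using equiv_class_eq[OF equiv_R] by (auto simp: amalgam_rel_def)

lemma inj_closed: "i \<in> I \<Longrightarrow> x \<in> carrier (G i) \<Longrightarrow> \<iota> i x \<in> carrier P"
  by (simp add: carrier_P amalgam_inj_def quotientI)

lemma ex_left_inverse: "u \<in> W \<Longrightarrow> \<exists>v\<in>W. amalgam_eq I G H \<phi> (v @ u) []"
proof (induction u)
  case Nil
  then show ?case by (intro bexI[of _ "[]"]) (auto intro: amalgam_eq.refl)
next
  case (Cons p u)
  obtain i x where p: "p = (i, x)" by (cases p)
  with Cons obtain v where v: "v \<in> W" "amalgam_eq I G H \<phi> (v @ u) []"
    and i: "i \<in> I" "x \<in> carrier (G i)" "u \<in> W" by auto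
  interpret Gi: group "G i" using group_G i by blast
  let ?y = "inv\<^bsub>G i\<^esub> x"
  have "amalgam_eq I G H \<phi> (v @ [(i, ?y), (i, x)] @ u) (v @ [(i, \<one>\<^bsub>G i\<^esub>)] @ u)"
    using amalgam_eq.mult[of v I G u i ?y x H \<phi>] v i by simp
  moreover have "amalgam_eq I G H \<phi> (v @ [(i, \<one>\<^bsub>G i\<^esub>)] @ u) (v @ u)"
    using v i by (intro amalgam_eq.one) auto
  ultimately have "amalgam_eq I G H \<phi> ((v @ [(i, ?y)]) @ p # u) []"
    using v(2) p by (auto intro: amalgam_eq.trans)
  then show ?case
    using v i by (intro bexI[of _ "v @ [(i, ?y)]"]) auto
qed

theorem group_P: "group P"
proof (rule groupI)
  show "\<one>\<^bsub>P\<^esub> \<in> carrier P" by (simp add: one_P carrier_P quotientI)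
next
  fix A B assume "A \<in> carrier P" "B \<in> carrier P"
  then show "A \<otimes>\<^bsub>P\<^esub> B \<in> carrier P"
    unfolding carrier_P by (elim quotientE) (simp add: mult_P quotientI)
next
  fix A B C assume "A \<in> carrier P" "B \<in> carrier P" "C \<in> carrier P"
  then show "A \<otimes>\<^bsub>P\<^esub> B \<otimes>\<^bsub>P\<^esub> C = A \<otimes>\<^bsub>P\<^esub> (B \<otimes>\<^bsub>P\<^esub> C)"
    unfolding carrier_P by (elim quotientE) (simp add: mult_P)
next
  fix A assume "A \<in> carrier P"
  then show "\<one>\<^bsub>P\<^esub> \<otimes>\<^bsub>P\<^esub> A = A"
    unfolding carrier_P one_P by (elim quotientE) (simp add: mult_P)
next
  fix A assume "A \<in> carrier P"
  then obtain u where u: "u \<in> W" "A = R `` {u}" unfolding carrier_P by (elim quotientE)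
  then obtain v where "v \<in> W" "amalgam_eq I G H \<phi> (v @ u) []" using ex_left_inverse by blast
  then show "\<exists>B\<in>carrier P. B \<otimes>\<^bsub>P\<^esub> A = \<one>\<^bsub>P\<^esub>"
    using u by (intro bexI[of _ "R `` {v}"]) (auto simp: mult_P one_P carrier_P quotientI class_eqI)
qed

theorem inj_hom:
  assumes "i \<in> I"
  shows "\<iota> i \<in> hom (G i) P"
proof (rule homI)
  fix x y assume xy: "x \<in> carrier (G i)" "y \<in> carrier (G i)"
  have "amalgam_eq I G H \<phi> [(i, x), (i, y)] [(i, x \<otimes>\<^bsub>G i\<^esub> y)]"
    using amalgam_eq.mult[of "[]" I G "[]" i x y] xy assms by simp
  then show "\<iota> i (x \<otimes>\<^bsub>G i\<^esub> y) = \<iota> i x \<otimes>\<^bsub>P\<^esub> \<iota> i y"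
    using xy assms by (simp add: amalgam_inj_def mult_P class_eqI)
qed (use assms in \<open>auto intro: inj_closed\<close>)

theorem inj_identify:
  assumes "i \<in> I" "j \<in> I" "h \<in> carrier H"
  shows "\<iota> i (\<phi> i h) = \<iota> j (\<phi> j h)"
  using amalgam_eq.identify[of "[]" I G "[]" i j h H \<phi>] assms
  by (simp add: amalgam_inj_def class_eqI)

text \<open>The following two theorems are the universal property of the amalgam.\<close>

theorem universal_exists:
  assumes "group K"
    and f: "\<And>i. i \<in> I \<Longrightarrow> f i \<in> hom (G i) K"
    and agree: "\<And>i j h. i \<in> I \<Longrightarrow> j \<in> I \<Longrightarrow> h \<in> carrier H \<Longrightarrow> f i (\<phi> i h) = f j (\<phi> j h)"
  shows "\<exists>F\<in>hom P K. \<forall>i\<in>I. \<forall>x\<in>carrier (G i). F (\<iota> i x) = f i x"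
proof -
  interpret K: group K by fact
  define ev where "ev u = foldr (\<lambda>(i, x) k. f i x \<otimes>\<^bsub>K\<^esub> k) u \<one>\<^bsub>K\<^esub>" for u
  have f_closed: "f i x \<in> carrier K" if "i \<in> I" "x \<in> carrier (G i)" for i x
    using f that by (auto simp: hom_def)
  have ev_simps: "ev [] = \<one>\<^bsub>K\<^esub>" "ev ((i, x) # u) = f i x \<otimes>\<^bsub>K\<^esub> ev u" for i x u
    by (simp_all add: ev_def)
  have ev_closed: "ev u \<in> carrier K" if "u \<in> W" for u
    using that by (induction u) (auto simp: ev_simps f_closed)
  have ev_append: "ev (u @ v) = ev u \<otimes>\<^bsub>K\<^esub> ev v" if "u \<in> W" "v \<in> W" for u v
    using that by (induction u) (auto simp: ev_simps f_closed ev_closed K.m_assoc)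
  have ev_eq: "ev u = ev v" if "amalgam_eq I G H \<phi> u v" for u v
    using that
  proof (induction rule: amalgam_eq.induct)
    case (mult u v i x y)
    then interpret Gi: group "G i" using group_G by blast
    have "f i (x \<otimes>\<^bsub>G i\<^esub> y) = f i x \<otimes>\<^bsub>K\<^esub> f i y" using f mult by (auto simp: hom_def)
    then show ?case using mult by (simp add: ev_append ev_simps f_closed ev_closed K.m_assoc)
  next
    case (one u v i)
    then interpret Gi: group "G i" using group_G by blast
    have "f i \<one>\<^bsub>G i\<^esub> = \<one>\<^bsub>K\<^esub>"
      using f one group_G \<open>group K\<close> by (intro hom_one) auto
    then show ?case using one by (simp add: ev_append ev_simps ev_closed)
  next
    case (identify u v i j h)
    then show ?case using agree[of i j h] by (simp add: ev_append ev_simps phi_closed)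
  qed auto
  define F where "F A = ev (SOME u. u \<in> A)" for A
  have F: "F (R `` {u}) = ev u" if "u \<in> W" for u
  proof -
    have "u \<in> R `` {u}" using equiv_class_self[OF equiv_R that] .
    then have "(SOME v. v \<in> R `` {u}) \<in> R `` {u}" by (rule someI)
    then show ?thesis unfolding F_def using ev_eq by (auto simp: amalgam_rel_def)
  qed
  show ?thesis
  proof
    show "F \<in> hom P K"
    proof (rule homI)
      fix A B assume "A \<in> carrier P" "B \<in> carrier P"
      then show "F (A \<otimes>\<^bsub>P\<^esub> B) = F A \<otimes>\<^bsub>K\<^esub> F B"
        unfolding carrier_P by (elim quotientE) (simp add: mult_P F ev_append)
    next
      fix A assume "A \<in> carrier P"
      then show "F A \<in> carrier K"
        unfolding carrier_P by (elim quotientE) (simp add: F ev_closed)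
    qed
    show "\<forall>i\<in>I. \<forall>x\<in>carrier (G i). F (\<iota> i x) = f i x"
      by (simp add: amalgam_inj_def F ev_simps f_closed)
  qed
qed

theorem universal_unique:
  assumes "group K" and F: "F \<in> hom P K" and F': "F' \<in> hom P K"
    and eq: "\<And>i x. i \<in> I \<Longrightarrow> x \<in> carrier (G i) \<Longrightarrow> F (\<iota> i x) = F' (\<iota> i x)"
    and "A \<in> carrier P"
  shows "F A = F' A"
proof -
  have "F (R `` {u}) = F' (R `` {u})" if "u \<in> W" for u
    using that
  proof (induction u)
    case Nil
    show ?case
      using hom_one[OF F group_P \<open>group K\<close>] hom_one[OF F' group_P \<open>group K\<close>] by (simp add: one_P)
  next
    case (Cons p u)
    obtain i x where p: "p = (i, x)" by (cases p)
    with Cons have i: "i \<in> I" "x \<in> carrier (G i)" "u \<in> W" by auto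
    have "R `` {p # u} = \<iota> i x \<otimes>\<^bsub>P\<^esub> R `` {u}"
      using i by (simp add: p amalgam_inj_def mult_P)
    moreover have "R `` {u} \<in> carrier P" using i by (simp add: carrier_P quotientI)
    ultimately show ?case
      using hom_mult[OF F inj_closed[OF i(1,2)]] hom_mult[OF F' inj_closed[OF i(1,2)]] eq i Cons
      by simp
  qed
  then show ?thesis using \<open>A \<in> carrier P\<close> unfolding carrier_P by (elim quotientE) simp
qed

end

end

theory Submission
  imports Defs
begin

text \<open>
  A convex proper subgroup of a circularly ordered group is linearly ordered, by cutting the circle at
  any point outside it (\<open>outside_indifferent\<close>), and its cosets again form a circle. The order of the
  group is lexicographic: first the circle of cosets, then the line in each coset
  (\<open>fiber_cmp_sum\<close>). Moreover the circular order of the subgroup alone determines its linear order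
  (\<open>sign_from_outside\<close>), so that order-preserving identifications of the subgroups \<open>Hs i\<close> with \<open>H\<close>
  respect these linear orders. It therefore suffices to arrange the cosets of \<open>H\<close> in the amalgam on an
  invariant circle.

  The cosets of \<open>H\<close> and of the \<open>G i\<close> are the vertices of the Bass-Serre tree of the amalgam. The
  edges at a coset of \<open>G i\<close> correspond to the cosets of \<open>Hs i\<close> in \<open>G i\<close>, so they lie on a circle. The
  edges at a coset of \<open>H\<close> correspond to the indices; hang one leaf on this vertex and put the
  indices and the leaf on any circle, the same for all cosets of \<open>H\<close>. The tree is thereby planar, and
  equivariantly so. Walking around a planar tree orders its leaves circularly, and the leaves are the
  cosets of \<open>H\<close>.

  The proof makes this explicit with normal forms, that is, reduced words of coset representatives
  followed by an element of \<open>H\<close>. They carry actions of the groups \<open>G i\<close> that satisfy the relations of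
  the amalgam, and the amalgam acts freely on the orbit of the empty word (\<open>orbit_inj\<close>). Cutting the
  circle turns it into a lexicographic order of normal forms (\<open>cmp\<close>). Multiplication by an
  element of \<open>G i\<close> only moves the place of the cut, so the circle is invariant (\<open>cyclic_act\<close>); on
  words with at most one letter from \<open>G i\<close> it is the circle of \<open>G i\<close> (\<open>cyclic_base\<close>).

  Linear orders are integer-valued functions throughout. The circular order of a linear order
  \<open>f\<close> is the coboundary \<open>f a b + f b e + f e a\<close>, and moving a cut adds a function \<open>F x - F y\<close>,
  which cancels in that sum.
\<close>

section \<open>Circular orders obtained from linear orders\<close>

text \<open>
  A strict linear order, as a function with values in \<open>{-1, 0, 1}\<close>: the value \<open>1\<close> means ``less''. With
  integer values, cutting a circular order at another point amounts to adding a coboundary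
  \<open>F x - F y\<close>, which replaces case distinctions by cancellation.
\<close>
definition comparison_on :: "'a set \<Rightarrow> ('a \<Rightarrow> 'a \<Rightarrow> int) \<Rightarrow> bool" where
  "comparison_on S f \<longleftrightarrow>
     (\<forall>a\<in>S. \<forall>b\<in>S. f a b \<in> {-1, 0, 1} \<and> (f a b = 0 \<longleftrightarrow> a = b) \<and> f b a = - f a b) \<and>
     (\<forall>a\<in>S. \<forall>b\<in>S. \<forall>e\<in>S. f a b = 1 \<longrightarrow> f b e = 1 \<longrightarrow> f a e = 1)"

text \<open>
  The circle obtained by closing up a line, as the coboundary of the order. The cocycle
  identity then needs only antisymmetry, and adding \<open>F x - F y\<close> to \<open>f x y\<close> changes nothing.
\<close>
definition cyclic :: "('a \<Rightarrow> 'a \<Rightarrow> int) \<Rightarrow> 'a \<Rightarrow> 'a \<Rightarrow> 'a \<Rightarrow> int" where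
  "cyclic f a b e = f a b + f b e + f e a"

lemma comparison_onD:
  assumes "comparison_on S f" "a \<in> S" "b \<in> S"
  shows "f a b \<in> {-1, 0, 1}" "f a b = 0 \<longleftrightarrow> a = b" "f b a = - f a b"
    and "\<And>e. e \<in> S \<Longrightarrow> f a b = 1 \<Longrightarrow> f b e = 1 \<Longrightarrow> f a e = 1"
  using assms unfolding comparison_on_def by (blast+)

lemma comparison_on_subset: "comparison_on S f \<Longrightarrow> T \<subseteq> S \<Longrightarrow> comparison_on T f"
  unfolding comparison_on_def by (meson subsetD)

text \<open>
  The arithmetic of three signs \<open>f a b\<close>, \<open>f b e\<close>, \<open>f e a\<close> when \<open>f\<close> is a linear order: transitivity
  prevents the sum from being \<open>3\<close> or \<open>-3\<close>, and a vanishing sign makes the other two cancel.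
\<close>
lemma signs_around_a_triangle:
  fixes p q r :: int
  assumes "p \<in> {-1, 0, 1}" "q \<in> {-1, 0, 1}" "r \<in> {-1, 0, 1}"
    and "p = 1 \<longrightarrow> q \<noteq> 1 \<or> r = -1" "q = 1 \<longrightarrow> r \<noteq> 1 \<or> p = -1" "r = 1 \<longrightarrow> p \<noteq> 1 \<or> q = -1"
    and "p = -1 \<longrightarrow> q \<noteq> -1 \<or> r = 1" "q = -1 \<longrightarrow> r \<noteq> -1 \<or> p = 1" "r = -1 \<longrightarrow> p \<noteq> -1 \<or> q = 1"
    and "p = 0 \<longrightarrow> q = - r" "q = 0 \<longrightarrow> r = - p" "r = 0 \<longrightarrow> p = - q"
  shows "p + q + r \<in> {-1, 0, 1}" "p + q + r = 0 \<longleftrightarrow> p = 0 \<or> q = 0 \<or> r = 0"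
proof -
  have "p + q + r \<in> {-1, 0, 1} \<and> (p + q + r = 0 \<longleftrightarrow> p = 0 \<or> q = 0 \<or> r = 0)"
    using assms(1-3) by (elim insertE emptyE; insert assms(4-); hypsubst; simp)
  then show "p + q + r \<in> {-1, 0, 1}" "p + q + r = 0 \<longleftrightarrow> p = 0 \<or> q = 0 \<or> r = 0" by blast+
qed

lemma cyclic_values:
  assumes f: "comparison_on S f" and S: "a \<in> S" "b \<in> S" "e \<in> S"
  shows "cyclic f a b e \<in> {-1, 0, 1}"
    and "cyclic f a b e = 0 \<longleftrightarrow> a = b \<or> a = e \<or> b = e"
proof -
  note D = comparison_onD[OF f]
  have pos: "f x y = 1 \<Longrightarrow> f y z = 1 \<Longrightarrow> f z x = -1" if "x \<in> S" "y \<in> S" "z \<in> S" for x y z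
    using D(4)[OF that] D(3)[of x z] that by simp
  have neg: "f x y = -1 \<Longrightarrow> f y z = -1 \<Longrightarrow> f z x = 1" if "x \<in> S" "y \<in> S" "z \<in> S" for x y z
    using D(4)[of z y x] D(3)[of x y] D(3)[of y z] that by simp
  have zero: "f x y = 0 \<Longrightarrow> f y z = - f z x" if "x \<in> S" "y \<in> S" "z \<in> S" for x y z
    using D(2)[of x y] D(3)[of z x] that by simp
  have "f a b \<in> {-1, 0, 1}" "f b e \<in> {-1, 0, 1}" "f e a \<in> {-1, 0, 1}"
    using D(1) S by blast+
  note * = signs_around_a_triangle[OF this]
  have "f a b + f b e + f e a \<in> {-1, 0, 1} \<and>
      (f a b + f b e + f e a = 0 \<longleftrightarrow> f a b = 0 \<or> f b e = 0 \<or> f e a = 0)"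
    using pos[OF S] pos[OF S(2,3,1)] pos[OF S(3,1,2)] neg[OF S] neg[OF S(2,3,1)] neg[OF S(3,1,2)]
      zero[OF S] zero[OF S(2,3,1)] zero[OF S(3,1,2)]
    by (intro conjI *) blast+
  then show "cyclic f a b e \<in> {-1, 0, 1}" "cyclic f a b e = 0 \<longleftrightarrow> a = b \<or> a = e \<or> b = e"
    using D(2)[of a b] D(2)[of b e] D(2)[of e a] S unfolding cyclic_def by auto
qed

lemma cyclic_cocycle:
  assumes "comparison_on S f" and "a1 \<in> S" "a2 \<in> S" "a3 \<in> S" "a4 \<in> S"
  shows "cyclic f a2 a3 a4 - cyclic f a1 a3 a4 + cyclic f a1 a2 a4 - cyclic f a1 a2 a3 = 0"
  using comparison_onD(3)[OF assms(1,3,5)] comparison_onD(3)[OF assms(1,2,4)]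
  unfolding cyclic_def by simp

lemma ex_comparison: "\<exists>f :: 'a \<Rightarrow> 'a \<Rightarrow> int. comparison_on UNIV f"
proof -
  obtain r :: "'a rel" where "well_order_on UNIV r" using well_order_on by blast
  then have r: "linear_order r" by (simp add: well_order_on_def)
  define f where "f a b = (if a = b then 0 else if (a, b) \<in> r then 1 else - 1 :: int)" for a b
  have ex: "a \<noteq> b \<Longrightarrow> (a, b) \<in> r \<longleftrightarrow> (b, a) \<notin> r" for a b
    using r unfolding linear_order_on_def partial_order_on_def antisym_def total_on_def by blast
  have tr: "(a, b) \<in> r \<Longrightarrow> (b, e) \<in> r \<Longrightarrow> (a, e) \<in> r" for a b e
    using r unfolding linear_order_on_def partial_order_on_def preorder_on_def
    by (blast dest: transD)
  have "comparison_on UNIV f"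
    unfolding comparison_on_def
  proof (intro conjI ballI impI)
    fix a b
    show "f a b \<in> {-1, 0, 1}" "f a b = 0 \<longleftrightarrow> a = b" by (simp_all add: f_def)
    show "f b a = - f a b" using ex[of a b] by (auto simp: f_def)
  next
    fix a b e assume "f a b = 1" "f b e = 1"
    then show "f a e = 1"
      using tr[of a b e] ex[of a b] by (auto simp: f_def split: if_splits)
  qed
  then show ?thesis by blast
qed

text \<open>
  The coboundary that moves the elements above \<open>p\<close> in front of all others; the factor \<open>2\<close> turns the
  value \<open>-1\<close> into \<open>1\<close>.
\<close>
definition offset :: "('a \<Rightarrow> 'a \<Rightarrow> int) \<Rightarrow> 'a \<Rightarrow> 'a \<Rightarrow> int" where
  "offset f p x = (if f p x = 1 then 2 else 0)"

text \<open>
  The line obtained by closing up the order \<open>f\<close> to a circle and cutting it immediately after \<open>p\<close>,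
  so that \<open>p\<close> becomes the last element.
\<close>
definition cut_after :: "('a \<Rightarrow> 'a \<Rightarrow> int) \<Rightarrow> 'a \<Rightarrow> 'a \<Rightarrow> 'a \<Rightarrow> int" where
  "cut_after f p x y = f x y + offset f p x - offset f p y"

text \<open>
  The new order first lists the elements above \<open>p\<close> and then the remaining ones, each part in its old
  order.
\<close>
lemma cut_after_comparison:
  assumes f: "comparison_on UNIV f"
  shows "comparison_on UNIV (cut_after f p)"
proof -
  have v: "f a b = -1 \<or> f a b = 0 \<or> f a b = 1" for a b
    using comparison_onD(1)[OF f] by auto
  have z: "f a b = 0 \<longleftrightarrow> a = b" for a b
    using comparison_onD(2)[OF f, of a b] by simp
  have s: "f b a = - f a b" for a b
    using comparison_onD(3)[OF f, of a b] by simp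
  have t: "f a b = 1 \<Longrightarrow> f b e = 1 \<Longrightarrow> f a e = 1" for a b e
    using comparison_onD(4)[OF f, of a b e] by simp
  have lower: "f p b = 1 \<Longrightarrow> f p a \<noteq> 1 \<Longrightarrow> f a b = 1" for a b
    using v[of p a] z[of p a] s[of p a] t[of a p b] by auto
  have "cut_after f p a b \<in> {-1, 0, 1} \<and> (cut_after f p a b = 0 \<longleftrightarrow> a = b)" for a b
    using v[of a b] z[of a b] lower[of a b] lower[of b a] s[of a b]
    unfolding cut_after_def offset_def by (auto split: if_splits)
  moreover have "cut_after f p b a = - cut_after f p a b" for a b
    using s[of a b] unfolding cut_after_def by simp
  moreover have one: "cut_after f p a b = 1 \<longleftrightarrow>
      (if f p a = 1 then f p b \<noteq> 1 \<or> f a b = 1 else f p b \<noteq> 1 \<and> f a b = 1)" for a b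
    using v[of a b] lower[of a b] lower[of b a] s[of a b]
    unfolding cut_after_def offset_def by auto
  have "cut_after f p a b = 1 \<Longrightarrow> cut_after f p b e = 1 \<Longrightarrow> cut_after f p a e = 1" for a b e
    unfolding one using t[of a b e] by (auto split: if_splits)
  ultimately show ?thesis unfolding comparison_on_def by blast
qed

lemma cut_after_last:
  assumes f: "comparison_on UNIV f" and "x \<noteq> p"
  shows "cut_after f p x p = 1"
proof -
  have "f x p \<in> {-1,0,1}" "f p p = 0" "f x p \<noteq> 0" "f p x = - f x p"
    using comparison_onD(1-3)[OF f, of x p] comparison_onD(2)[OF f, of p p] \<open>x \<noteq> p\<close> by auto
  then show ?thesis unfolding cut_after_def offset_def by auto
qed

section \<open>Convex subgroups of a circularly ordered group\<close>

text \<open>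
  The left-invariant comparison that declares \<open>x\<close> positive if \<open>inv x\<close>, \<open>1\<close>, \<open>x\<close> are in positive
  circular position. On a convex proper subgroup this is the linear order obtained by cutting the
  circle at any point outside. The formula mentions only the circular order of the subgroup itself,
  which is why all factors of the amalgam induce the same linear order on \<open>H\<close>.
\<close>
definition sign_cmp :: "('h, 'n) monoid_scheme \<Rightarrow> ('h \<Rightarrow> 'h \<Rightarrow> 'h \<Rightarrow> int) \<Rightarrow> 'h \<Rightarrow> 'h \<Rightarrow> int" where
  "sign_cmp H d a b = (let x = inv\<^bsub>H\<^esub> a \<otimes>\<^bsub>H\<^esub> b in d (inv\<^bsub>H\<^esub> x) \<one>\<^bsub>H\<^esub> x)"

lemma (in group) inv_cancel_left:
  assumes "x \<in> carrier G" "y \<in> carrier G"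
  shows "inv x \<otimes> (x \<otimes> y) = y" "x \<otimes> (inv x \<otimes> y) = y"
  using assms by (simp_all add: m_assoc[symmetric])

lemma (in group) sign_cmp_left_mult:
  assumes "a \<in> carrier G" "b \<in> carrier G" "g \<in> carrier G"
  shows "sign_cmp G d (g \<otimes> a) (g \<otimes> b) = sign_cmp G d a b"
proof -
  have "inv (g \<otimes> a) \<otimes> (g \<otimes> b) = inv a \<otimes> b"
    using assms by (simp add: inv_mult_group m_assoc inv_cancel_left)
  then show ?thesis unfolding sign_cmp_def by simp
qed

text \<open>
  One factor of the amalgam: a circularly ordered group \<open>G\<close> whose convex subgroup \<open>K\<close> is the image
  of \<open>H\<close>.
\<close>
locale circular_factor = group G + H: group H
  for G :: "('a, 'm) monoid_scheme" (structure) and c :: "'a \<Rightarrow> 'a \<Rightarrow> 'a \<Rightarrow> int" and K :: "'a set"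
    and H :: "('h, 'n) monoid_scheme" and d :: "'h \<Rightarrow> 'h \<Rightarrow> 'h \<Rightarrow> int" and \<phi> :: "'h \<Rightarrow> 'a" +
  assumes ordering: "circular_ordering G c"
    and convex: "convex_subgroup K G c"
    and phi_iso: "\<phi> \<in> iso H (G\<lparr>carrier := K\<rparr>)"
    and phi_order: "order_preserving H d c \<phi>"
begin

lemma c_values: "\<lbrakk>x \<in> carrier G; y \<in> carrier G; z \<in> carrier G\<rbrakk> \<Longrightarrow> c x y z \<in> {-1, 0, 1}"
  and c_zero: "\<lbrakk>x \<in> carrier G; y \<in> carrier G; z \<in> carrier G\<rbrakk> \<Longrightarrow>
    c x y z = 0 \<longleftrightarrow> x = y \<or> x = z \<or> y = z"
  and c_cocycle: "\<lbrakk>x \<in> carrier G; y \<in> carrier G; z \<in> carrier G; w \<in> carrier G\<rbrakk> \<Longrightarrow>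
    c y z w - c x z w + c x y w - c x y z = 0"
  and c_left: "\<lbrakk>g \<in> carrier G; x \<in> carrier G; y \<in> carrier G; z \<in> carrier G\<rbrakk> \<Longrightarrow>
    c (g \<otimes> x) (g \<otimes> y) (g \<otimes> z) = c x y z"
  using ordering unfolding circular_ordering_def by blast+

lemma c_swap12: "\<lbrakk>x \<in> carrier G; y \<in> carrier G; z \<in> carrier G\<rbrakk> \<Longrightarrow> c y x z = - c x y z"
  using c_cocycle[of x y x z] c_zero[of x x z] c_zero[of x y x] by auto

lemma c_swap23: "\<lbrakk>x \<in> carrier G; y \<in> carrier G; z \<in> carrier G\<rbrakk> \<Longrightarrow> c x z y = - c x y z"
  using c_cocycle[of x y z y] c_zero[of y z y] c_zero[of x y y] by auto

lemma c_rotate: "\<lbrakk>x \<in> carrier G; y \<in> carrier G; z \<in> carrier G\<rbrakk> \<Longrightarrow> c y z x = c x y z"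
  using c_swap12[of x y z] c_swap23[of y x z] by auto

lemma cut_at_comparison:
  assumes "g \<in> carrier G"
  shows "comparison_on (carrier G - {g}) (c g)"
  unfolding comparison_on_def
proof (intro conjI ballI impI)
  fix a b assume "a \<in> carrier G - {g}" "b \<in> carrier G - {g}"
  then show "c g a b \<in> {-1, 0, 1}" "c g a b = 0 \<longleftrightarrow> a = b" "c g b a = - c g a b"
    using c_values[of g a b] c_zero[of g a b] c_swap23[of g a b] assms by auto
next
  fix a b e
  assume "a \<in> carrier G - {g}" "b \<in> carrier G - {g}" "e \<in> carrier G - {g}"
    "c g a b = 1" "c g b e = 1"
  then show "c g a e = 1"
    using c_cocycle[of g a b e] c_values[of a b e] c_values[of g a e] assms by auto
qed

lemma K_subgroup: "subgroup K G" and K_proper: "K \<noteq> carrier G"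
  using convex unfolding convex_subgroup_def by auto

lemma K_carrier: "x \<in> K \<Longrightarrow> x \<in> carrier G"
  using subgroup.mem_carrier[OF K_subgroup] .

lemma ex_outside: "\<exists>g\<in>carrier G. g \<notin> K"
  using K_proper subgroup.subset[OF K_subgroup] by blast

text \<open>
  This is what convexity is used for: if \<open>a\<close> and \<open>b\<close> were seen in different orders from two outside
  points, then the two arcs between \<open>a\<close> and \<open>b\<close> would both leave \<open>K\<close>.
\<close>
lemma outside_indifferent:
  assumes "g \<in> carrier G - K" "g' \<in> carrier G - K" "a \<in> K" "b \<in> K"
  shows "c g a b = c g' a b"
proof -
  have conv: False if "u \<in> carrier G - K" "v \<in> carrier G - K" "c u a b = 1" "c v a b = -1" for u v
  proof -
    have "c b u a = 1" "c a v b = 1"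
      using that c_rotate[of b u a] c_swap12[of a v b] assms K_carrier[of a] K_carrier[of b] by auto
    then show False
      using convex that assms unfolding convex_subgroup_def by blast
  qed
  show ?thesis
    using c_values[of g a b] c_values[of g' a b] c_zero[of g a b] c_zero[of g' a b]
      conv[of g g'] conv[of g' g] assms K_carrier[of a] K_carrier[of b]
    by auto
qed

definition same :: "'a \<Rightarrow> 'a \<Rightarrow> bool"  (infix "\<asymp>" 50) where
  "x \<asymp> y \<longleftrightarrow> inv x \<otimes> y \<in> K"

lemma same_refl: "x \<in> carrier G \<Longrightarrow> x \<asymp> x"
  unfolding same_def using subgroup.one_closed[OF K_subgroup] by simp

lemma same_sym: "x \<in> carrier G \<Longrightarrow> y \<in> carrier G \<Longrightarrow> x \<asymp> y \<longleftrightarrow> y \<asymp> x"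
  unfolding same_def using subgroup.m_inv_closed[OF K_subgroup, of "inv x \<otimes> y"]
  subgroup.m_inv_closed[OF K_subgroup, of "inv y \<otimes> x"] by (auto simp: inv_mult_group)

lemma same_trans:
  assumes "x \<in> carrier G" "y \<in> carrier G" "z \<in> carrier G" "x \<asymp> y" "y \<asymp> z" shows "x \<asymp> z"
proof -
  have "(inv x \<otimes> y) \<otimes> (inv y \<otimes> z) = inv x \<otimes> z"
    using assms by (simp add: m_assoc inv_cancel_left)
  then show ?thesis
    using subgroup.m_closed[OF K_subgroup, of "inv x \<otimes> y" "inv y \<otimes> z"] assms
    unfolding same_def by simp
qed

lemma same_left: "\<lbrakk>g \<in> carrier G; x \<in> carrier G; y \<in> carrier G\<rbrakk> \<Longrightarrow> g \<otimes> x \<asymp> g \<otimes> y \<longleftrightarrow> x \<asymp> y"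
  unfolding same_def by (simp add: inv_mult_group m_assoc inv_cancel_left)

lemma same_one: "x \<in> carrier G \<Longrightarrow> \<one> \<asymp> x \<longleftrightarrow> x \<in> K"
  unfolding same_def by simp

text \<open>
  The circular order of \<open>G\<close> is lexicographic: the cosets of \<open>K\<close> form a circle, ordered by
  \<open>between\<close>, and each of its points is blown up to a copy of the line \<open>K\<close>, ordered by \<open>fiber_cmp\<close>.
  Lemma \<open>fiber_cmp_sum\<close> below is the precise form of this description.
\<close>
definition fiber_cmp :: "'a \<Rightarrow> 'a \<Rightarrow> int" where
  "fiber_cmp x y = (if x \<asymp> y then sign_cmp G c x y else 0)"

definition between :: "'a \<Rightarrow> 'a \<Rightarrow> 'a \<Rightarrow> int" where
  "between x y z = (if x \<asymp> y \<or> y \<asymp> z \<or> x \<asymp> z then 0 else c x y z)"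

text \<open>
  The cocycle identity for \<open>g\<close>, \<open>inv h\<close>, \<open>1\<close>, \<open>h\<close> does it: from \<open>g\<close>, the step from \<open>inv h\<close> to \<open>1\<close>
  and the step from \<open>1\<close> to \<open>h\<close> have the same sign, because left multiplication by \<open>h\<close> carries one
  to the other and moves \<open>g\<close> only to another outside point.
\<close>
lemma sign_from_outside:
  assumes "g \<in> carrier G" "h \<in> K" "g \<notin> K"
  shows "c g \<one> h = c (inv h) \<one> h"
proof -
  have h: "h \<in> carrier G" "inv h \<in> K" "\<one> \<in> K"
    using assms K_carrier subgroup.m_inv_closed[OF K_subgroup] subgroup.one_closed[OF K_subgroup]
    by auto
  have hg: "h \<otimes> g \<in> carrier G - K"
    using assms h subgroup.m_closed[OF K_subgroup, of "inv h" "h \<otimes> g"]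
    by (auto simp: m_assoc[symmetric])
  have "c g (inv h) \<one> = c (h \<otimes> g) \<one> h"
    using c_left[of h g "inv h" \<one>] assms h by simp
  also have "\<dots> = c g \<one> h"
    using outside_indifferent[OF hg] assms h by blast
  finally have "c g (inv h) \<one> = c g \<one> h" .
  moreover have "c (inv h) \<one> h - c g \<one> h + c g (inv h) h - c g (inv h) \<one> = 0"
    using c_cocycle assms h by simp
  ultimately have sum: "c (inv h) \<one> h = 2 * c g \<one> h - c g (inv h) h" by simp
  show ?thesis
  proof (cases "h = \<one>")
    case True
    then show ?thesis using c_zero[of g \<one> \<one>] c_zero[of \<one> \<one> \<one>] assms(1) by simp
  next
    case False
    then have "c g \<one> h \<in> {-1, 1}"
      using c_values[of g \<one> h] c_zero[of g \<one> h] assms h by auto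
    moreover have "c (inv h) \<one> h \<in> {-1, 0, 1}" "c g (inv h) h \<in> {-1, 0, 1}"
      using c_values assms h by simp_all
    ultimately show ?thesis using sum by auto
  qed
qed

lemma fiber_cmp_eq:
  assumes "x \<in> carrier G" "y \<in> carrier G" "g \<in> carrier G" "x \<asymp> y" "\<not> x \<asymp> g"
  shows "c g x y = fiber_cmp x y"
proof -
  have "c g x y = c (inv x \<otimes> g) \<one> (inv x \<otimes> y)"
    using c_left[of "inv x" g x y] assms by simp
  also have "\<dots> = fiber_cmp x y"
    using sign_from_outside[of "inv x \<otimes> g" "inv x \<otimes> y"] assms
    unfolding fiber_cmp_def sign_cmp_def same_def Let_def by simp
  finally show ?thesis .
qed

lemma between_swap:
  assumes "x \<in> carrier G" "y \<in> carrier G" "z \<in> carrier G"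
  shows "between y x z = - between x y z" "between x z y = - between x y z"
  using assms c_swap12[of x y z] c_swap23[of x y z] same_sym[of x y] same_sym[of y z]
  unfolding between_def by auto

text \<open>
  An outside point \<open>y\<close> or \<open>z\<close> sees \<open>x\<close> and \<open>x'\<close> in the same order, so the cocycle identity
  for \<open>x\<close>, \<open>x'\<close>, \<open>y\<close>, \<open>z\<close> reduces to the claim. Hence \<open>between\<close> is a function of cosets.
\<close>
lemma between_cong1:
  assumes "x \<in> carrier G" "x' \<in> carrier G" "y \<in> carrier G" "z \<in> carrier G" "x \<asymp> x'"
  shows "between x y z = between x' y z"
proof (cases "x \<asymp> y \<or> y \<asymp> z \<or> x \<asymp> z")
  case True
  then show ?thesis
    using assms same_trans[of x' x y] same_trans[of x' x z] same_sym[of x x']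
    unfolding between_def by auto
next
  case False
  then have F: "\<not> x' \<asymp> y" "\<not> x' \<asymp> z"
    using assms same_trans[of x x' y] same_trans[of x x' z] by auto
  have "c x x' y = c x x' z"
    using fiber_cmp_eq[of x x' y] fiber_cmp_eq[of x x' z] False assms c_rotate[of x x' y] c_rotate[of x x' z]
     c_rotate[of y x x'] c_rotate[of z x x'] by auto
  then show ?thesis
    using c_cocycle[of x x' y z] False F assms unfolding between_def by auto
qed

lemma between_cong2:
  assumes "x \<in> carrier G" "y \<in> carrier G" "y' \<in> carrier G" "z \<in> carrier G" "y \<asymp> y'"
  shows "between x y z = between x y' z"
  using between_cong1[of y y' x z] between_swap(1)[of x y z] between_swap(1)[of x y' z] assms by simp

lemma between_cong3:
  assumes "x \<in> carrier G" "y \<in> carrier G" "z \<in> carrier G" "z' \<in> carrier G" "z \<asymp> z'"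
  shows "between x y z = between x y z'"
  using between_cong2[of x z z' y] between_swap(2)[of x y z] between_swap(2)[of x y z'] assms by simp

lemma between_degenerate:
  assumes "x \<asymp> y \<or> y \<asymp> z \<or> x \<asymp> z"
  shows "between x y z = 0"
  using assms unfolding between_def by simp

lemma between_cocycle:
  assumes "x \<in> carrier G" "y \<in> carrier G" "z \<in> carrier G" "w \<in> carrier G"
  shows "between y z w - between x z w + between x y w - between x y z = 0"
proof -
  consider "x \<asymp> y" | "x \<asymp> z" | "x \<asymp> w" | "y \<asymp> z" | "y \<asymp> w" | "z \<asymp> w"
    | "\<not> x \<asymp> y" "\<not> x \<asymp> z" "\<not> x \<asymp> w" "\<not> y \<asymp> z" "\<not> y \<asymp> w" "\<not> z \<asymp> w"
    by blast
  then show ?thesis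
  proof cases
    case 1
    then show ?thesis using between_cong1[of x y z w] assms by (simp add: between_degenerate)
  next
    case 2
    then show ?thesis using between_cong1[of x z y w] between_swap(1)[of y z w] assms
      by (simp add: between_degenerate)
  next
    case 3
    then show ?thesis
      using between_cong1[of x w y z] between_swap(2)[of y w z] between_swap(1)[of w y z] assms
      by (simp add: between_degenerate)
  next
    case 4
    then show ?thesis using between_cong2[of x y z w] assms by (simp add: between_degenerate)
  next
    case 5
    then show ?thesis using between_cong2[of x y w z] between_swap(2)[of x z w] assms
      by (simp add: between_degenerate)
  next
    case 6
    then show ?thesis using between_cong3[of x y z w] assms by (simp add: between_degenerate)
  next
    case 7
    then show ?thesis using c_cocycle[of x y z w] assms unfolding between_def by simp
  qed
qed

lemma between_left:
  assumes "g \<in> carrier G" "x \<in> carrier G" "y \<in> carrier G" "z \<in> carrier G"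
  shows "between (g \<otimes> x) (g \<otimes> y) (g \<otimes> z) = between x y z"
  using assms by (simp add: between_def c_left same_left)

lemma fiber_cmp_sum:
  assumes "x \<in> carrier G" "y \<in> carrier G" "z \<in> carrier G"
  shows "c x y z = between x y z + fiber_cmp x y + fiber_cmp y z + fiber_cmp z x"
proof -
  consider (a) "x \<asymp> y" "y \<asymp> z" "x \<asymp> z" | (b) "x \<asymp> y" "\<not> y \<asymp> z" "\<not> x \<asymp> z"
    | (cc) "\<not> x \<asymp> y" "y \<asymp> z" "\<not> x \<asymp> z" | (dd) "\<not> x \<asymp> y" "\<not> y \<asymp> z" "x \<asymp> z"
    | (e) "\<not> x \<asymp> y" "\<not> y \<asymp> z" "\<not> x \<asymp> z"
    using same_trans[of x y z] same_trans[of x z y] same_trans[of y x z] same_sym[of x y]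
      same_sym[of y z] assms by blast
  then show ?thesis
  proof cases
    case a
    \<comment> \<open>From a point \<open>g\<close> of another coset, the coset of \<open>x\<close>, \<open>y\<close>, \<open>z\<close> looks like a line.\<close>
    obtain k where k: "k \<in> carrier G" "k \<notin> K" using ex_outside by blast
    define g where "g = x \<otimes> k"
    have g: "g \<in> carrier G" "\<not> x \<asymp> g" unfolding g_def same_def using k assms
      by (auto simp: m_assoc[symmetric])
    have g2: "\<not> y \<asymp> g" "\<not> z \<asymp> g"
      using same_trans[of x y g] same_trans[of x z g] g a assms by auto
    have "c g x y = fiber_cmp x y" "c g y z = fiber_cmp y z" "c g z x = fiber_cmp z x"
      using fiber_cmp_eq[of x y g] fiber_cmp_eq[of y z g] fiber_cmp_eq[of z x g] same_sym[of x z] a g g2 assms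
      by auto
    then show ?thesis
      using c_cocycle[of g x y z] c_swap23[of g x z] a g assms by (simp add: between_def)
  next
    case b
    then show ?thesis
      using fiber_cmp_eq[of x y z] c_rotate[of x y z] c_rotate[of y z x] same_sym[of x z] assms
      by (simp add: between_def fiber_cmp_def)
  next
    case cc
    then show ?thesis
      using fiber_cmp_eq[of y z x] same_sym[of x y] same_sym[of x z] assms
      by (simp add: between_def fiber_cmp_def)
  next
    case dd
    then show ?thesis
      using fiber_cmp_eq[of z x y] c_rotate[of x y z] same_sym[of x z] same_sym[of y z] c_rotate[of y z x] assms
      by (simp add: between_def fiber_cmp_def)
  next
    case e
    then show ?thesis
      using same_sym[of x z] assms by (simp add: between_def fiber_cmp_def)
  qed
qed

text \<open>
  The line of cosets obtained by cutting the circle immediately before \<open>p\<close>: between two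
  cosets other than that of \<open>p\<close> only the first summand counts, and the other two place \<open>p\<close> first.
\<close>
definition coset_cmp :: "'a \<Rightarrow> 'a \<Rightarrow> 'a \<Rightarrow> int" where
  "coset_cmp p x y = between p x y + of_bool (p \<asymp> x) - of_bool (p \<asymp> y)"

lemma coset_cmp_left:
  assumes "g \<in> carrier G" "p \<in> carrier G" "x \<in> carrier G" "y \<in> carrier G"
  shows "coset_cmp (g \<otimes> p) (g \<otimes> x) (g \<otimes> y) = coset_cmp p x y"
  using assms by (simp add: coset_cmp_def between_left same_left)

text \<open>
  The coboundary that moves the cut from \<open>p\<close> to \<open>q\<close>.
\<close>
definition recut :: "'a \<Rightarrow> 'a \<Rightarrow> 'a \<Rightarrow> int" where
  "recut p q x = between p q x + of_bool (q \<asymp> x) - of_bool (p \<asymp> x)"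

text \<open>
  The cocycle identity of \<open>between\<close> says that its values at base points \<open>p\<close> and \<open>q\<close> differ by
  a coboundary.
\<close>
lemma coset_cmp_recut:
  assumes "p \<in> carrier G" "q \<in> carrier G" "x \<in> carrier G" "y \<in> carrier G"
  shows "coset_cmp q x y = coset_cmp p x y + recut p q x - recut p q y"
  using between_cocycle[of p q x y] assms unfolding coset_cmp_def recut_def by simp

lemma c_eq_cyclic:
  assumes "x \<in> carrier G" "y \<in> carrier G" "z \<in> carrier G" "p \<in> carrier G"
  shows "c x y z = cyclic (\<lambda>x y. coset_cmp p x y + fiber_cmp x y) x y z"
  using fiber_cmp_sum[of x y z] between_cocycle[of p x y z] between_swap(2)[of p x z] assms
  unfolding cyclic_def coset_cmp_def by simp

section \<open>Coset representatives in one factor\<close>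

lemma phi_K: "h \<in> carrier H \<Longrightarrow> \<phi> h \<in> K"
  using phi_iso by (auto simp: iso_def hom_def)

lemma phi_closed: "h \<in> carrier H \<Longrightarrow> \<phi> h \<in> carrier G"
  using phi_K K_carrier by blast

lemma phi_mult: "\<lbrakk>h \<in> carrier H; k \<in> carrier H\<rbrakk> \<Longrightarrow> \<phi> (h \<otimes>\<^bsub>H\<^esub> k) = \<phi> h \<otimes> \<phi> k"
  using phi_iso by (auto simp: iso_def hom_def)

lemma phi_bij: "bij_betw \<phi> (carrier H) K"
  using phi_iso by (auto simp: iso_def)

lemma phi_inj: "\<lbrakk>h \<in> carrier H; k \<in> carrier H\<rbrakk> \<Longrightarrow> \<phi> h = \<phi> k \<longleftrightarrow> h = k"
  using phi_bij by (auto simp: bij_betw_def inj_on_def)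

lemma phi_hom: "\<phi> \<in> hom H G"
  using phi_closed phi_mult by (auto simp: hom_def)

lemma phi_one: "\<phi> \<one>\<^bsub>H\<^esub> = \<one>"
  using hom_one[OF phi_hom H.is_group is_group] .

lemma phi_inv: "h \<in> carrier H \<Longrightarrow> \<phi> (inv\<^bsub>H\<^esub> h) = inv (\<phi> h)"
  using group_hom.hom_inv[OF group_hom.intro[OF H.is_group is_group group_hom_axioms.intro[OF phi_hom]]] .

lemma sign_cmp_phi:
  assumes "a \<in> carrier H" "b \<in> carrier H"
  shows "sign_cmp H d a b = sign_cmp G c (\<phi> a) (\<phi> b)"
proof -
  have "d x y z = c (\<phi> x) (\<phi> y) (\<phi> z)" if "x \<in> carrier H" "y \<in> carrier H" "z \<in> carrier H" for x y z
    using phi_order that unfolding order_preserving_def by blast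
  then show ?thesis
    using assms unfolding sign_cmp_def Let_def by (simp add: phi_mult phi_inv phi_one)
qed

text \<open>
  The comparison is the restriction to \<open>K\<close> of the line obtained by cutting \<open>G\<close> at an outside point.
\<close>
lemma sign_cmp_comparison: "comparison_on (carrier H) (sign_cmp H d)"
proof -
  obtain g where g: "g \<in> carrier G" "g \<notin> K" using ex_outside by blast
  have phi: "\<phi> a \<in> carrier G - {g}" if "a \<in> carrier H" for a
    using phi_K[OF that] phi_closed[OF that] g by blast
  have eq: "sign_cmp H d a b = c g (\<phi> a) (\<phi> b)" if ab: "a \<in> carrier H" "b \<in> carrier H" for a b
  proof -
    have s: "\<phi> a \<asymp> \<phi> b"
      using phi_K[of "inv\<^bsub>H\<^esub> a \<otimes>\<^bsub>H\<^esub> b"] ab unfolding same_def by (simp add: phi_mult phi_inv)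
    have "\<one> \<asymp> \<phi> a" "\<not> \<one> \<asymp> g"
      using same_one phi_closed phi_K ab g by auto
    then have "\<not> \<phi> a \<asymp> g"
      using same_trans[of \<one> "\<phi> a" g] phi_closed ab g by auto
    then show ?thesis
      using fiber_cmp_eq[of "\<phi> a" "\<phi> b" g] s phi_closed ab g
      by (simp add: fiber_cmp_def sign_cmp_phi)
  qed
  note D = comparison_onD[OF cut_at_comparison[OF g(1)]]
  show ?thesis
    unfolding comparison_on_def
  proof (intro conjI ballI impI)
    fix a b assume ab: "a \<in> carrier H" "b \<in> carrier H"
    then show "sign_cmp H d a b \<in> {-1, 0, 1}" "sign_cmp H d a b = 0 \<longleftrightarrow> a = b"
      "sign_cmp H d b a = - sign_cmp H d a b"
      using D(1-3)[OF phi[OF ab(1)] phi[OF ab(2)]] phi_inj[of a b] by (simp_all add: eq)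
  next
    fix a b e assume ab: "a \<in> carrier H" "b \<in> carrier H" "e \<in> carrier H"
      "sign_cmp H d a b = 1" "sign_cmp H d b e = 1"
    then show "sign_cmp H d a e = 1"
      using D(4)[OF phi[OF ab(1)] phi[OF ab(2)] phi[OF ab(3)]] by (simp add: eq)
  qed
qed

text \<open>
  A transversal of \<open>K\<close>. The subgroup itself is represented by the identity, so that a missing
  letter in a normal form can be read as the representative of \<open>K\<close>. Every \<open>x\<close> is \<open>rep x\<close> times the image of \<open>rest x\<close>.
\<close>
definition rep :: "'a \<Rightarrow> 'a" where
  "rep x = (if x \<in> K then \<one> else SOME y. y \<in> carrier G \<and> x \<asymp> y)"

definition rest :: "'a \<Rightarrow> 'h" where
  "rest x = inv_into (carrier H) \<phi> (inv (rep x) \<otimes> x)"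

lemma rep_props:
  assumes "x \<in> carrier G"
  shows "rep x \<in> carrier G" "x \<asymp> rep x" "rep x \<asymp> x"
proof -
  have "rep x \<in> carrier G \<and> x \<asymp> rep x"
  proof (cases "x \<in> K")
    case True
    then show ?thesis
      using assms same_sym[of \<one> x] same_one[of x] by (simp add: rep_def)
  next
    case False
    then show ?thesis
      using someI[of "\<lambda>y. y \<in> carrier G \<and> x \<asymp> y" x] assms same_refl by (simp add: rep_def)
  qed
  then show "rep x \<in> carrier G" "x \<asymp> rep x" "rep x \<asymp> x" using same_sym assms by auto
qed

lemma same_K: "\<lbrakk>x \<in> carrier G; y \<in> carrier G; x \<asymp> y\<rbrakk> \<Longrightarrow> x \<in> K \<longleftrightarrow> y \<in> K"
  using same_trans[of \<one> x y] same_trans[of \<one> y x] same_sym[of x y] same_one by auto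

lemma rep_eq_iff:
  assumes "x \<in> carrier G" "y \<in> carrier G"
  shows "rep x = rep y \<longleftrightarrow> x \<asymp> y"
proof
  assume "rep x = rep y"
  then show "x \<asymp> y" using rep_props[of x] rep_props[of y] same_trans[of x "rep x" y] assms by auto
next
  assume "x \<asymp> y"
  then have "z \<in> carrier G \<and> x \<asymp> z \<longleftrightarrow> z \<in> carrier G \<and> y \<asymp> z" for z
    using same_trans[of x y z] same_trans[of y x z] same_sym[of x y] assms by blast
  then show "rep x = rep y"
    using same_K[OF assms \<open>x \<asymp> y\<close>] unfolding rep_def by simp
qed

lemma rep_rep: "x \<in> carrier G \<Longrightarrow> rep (rep x) = rep x"
  using rep_eq_iff rep_props by blast

lemma rep_one_iff: "x \<in> carrier G \<Longrightarrow> rep x = \<one> \<longleftrightarrow> x \<in> K"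
  using rep_eq_iff[of \<one> x] same_one[of x] subgroup.one_closed[OF K_subgroup]
  by (auto simp: rep_def)

lemma rep_in_K: "x \<in> carrier G \<Longrightarrow> rep x \<in> K \<longleftrightarrow> x \<in> K"
  using same_K rep_props by blast

lemma rest_props:
  assumes "x \<in> carrier G"
  shows "rest x \<in> carrier H" "\<phi> (rest x) = inv (rep x) \<otimes> x" "rep x \<otimes> \<phi> (rest x) = x"
proof -
  have "inv (rep x) \<otimes> x \<in> \<phi> ` carrier H"
    using rep_props(3)[OF assms] phi_bij unfolding same_def bij_betw_def by simp
  then show "rest x \<in> carrier H" "\<phi> (rest x) = inv (rep x) \<otimes> x"
    unfolding rest_def by (auto intro: inv_into_into f_inv_into_f)
  then show "rep x \<otimes> \<phi> (rest x) = x"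
    using assms rep_props(1)[OF assms] by (simp add: m_assoc[symmetric])
qed

lemma rep_mult_rep: "\<lbrakk>x \<in> carrier G; y \<in> carrier G\<rbrakk> \<Longrightarrow> rep (x \<otimes> rep y) = rep (x \<otimes> y)"
  using rep_eq_iff[of "x \<otimes> rep y" "x \<otimes> y"] same_left[of x "rep y" y] rep_props[of y] by simp

lemma rest_mult_rep:
  assumes "x \<in> carrier G" "y \<in> carrier G"
  shows "rest (x \<otimes> rep y) \<otimes>\<^bsub>H\<^esub> rest y = rest (x \<otimes> y)"
proof -
  have "\<phi> (rest (x \<otimes> rep y) \<otimes>\<^bsub>H\<^esub> rest y) = inv (rep (x \<otimes> y)) \<otimes> (x \<otimes> rep y) \<otimes> (inv (rep y) \<otimes> y)"
    using assms rest_props rep_props rep_mult_rep by (simp add: phi_mult)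
  also have "\<dots> = inv (rep (x \<otimes> y)) \<otimes> (x \<otimes> y)"
    using assms rep_props[of y] rep_props[of "x \<otimes> y"]
    by (simp add: m_assoc inv_cancel_left)
  also have "\<dots> = \<phi> (rest (x \<otimes> y))"
    using assms rest_props by simp
  finally show ?thesis
    using phi_inj[of "rest (x \<otimes> rep y) \<otimes>\<^bsub>H\<^esub> rest y" "rest (x \<otimes> y)"] rest_props(1) rep_props(1) assms
    by simp
qed

lemma rest_phi: "h \<in> carrier H \<Longrightarrow> rest (\<phi> h) = h"
  using rest_props[of "\<phi> h"] phi_K[of h] phi_closed[of h] phi_inj by (auto simp: rep_def)

lemma rest_one: "x \<in> carrier G \<Longrightarrow> rep x = x \<Longrightarrow> rest x = \<one>\<^bsub>H\<^esub>"
  using rest_props[of x] phi_inj[of "rest x" "\<one>\<^bsub>H\<^esub>"] by (simp add: phi_one)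

lemma fiber_cmp_rest:
  assumes "x \<in> carrier G" "y \<in> carrier G" "x \<asymp> y"
  shows "fiber_cmp x y = sign_cmp H d (rest x) (rest y)"
proof -
  have "sign_cmp H d (rest x) (rest y) = sign_cmp G c (\<phi> (rest x)) (\<phi> (rest y))"
    using assms rest_props by (simp add: sign_cmp_phi)
  also have "\<dots> = sign_cmp G c x y"
    using rest_props[OF assms(1)] rest_props[OF assms(2)] rep_eq_iff[OF assms(1,2)] assms
      sign_cmp_left_mult[of x y "inv (rep x)"] rep_props(1)[OF assms(1)] by simp
  finally show ?thesis using assms by (simp add: fiber_cmp_def)
qed

end

section \<open>Normal forms and the action of the factors\<close>

text \<open>
  \<open>Node i1 s1 (\<dots> (Node in sn (Leaf h)))\<close> encodes the product \<open>s1 \<dots> sn h\<close>, where \<open>sk\<close> is a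
  letter of the factor \<open>G ik\<close>.
\<close>
datatype ('i, 'a, 'h) nf = Leaf 'h | Node 'i 'a "('i, 'a, 'h) nf"

primrec tag :: "('i, 'a, 'h) nf \<Rightarrow> 'i option" where
  "tag (Leaf h) = None"
| "tag (Node i s t) = Some i"

text \<open>
  The linear order \<open>tag_cmp\<close> on \<open>'i option\<close> is an arbitrary choice; it orders the factors around each
  coset of \<open>H\<close> in the tree of cosets. Some factor is needed to represent the elements of \<open>H\<close> by words.
\<close>
locale circular_amalgam = H: group H
  for I :: "'i set" and G :: "'i \<Rightarrow> ('a, 'm) monoid_scheme"
    and c :: "'i \<Rightarrow> 'a \<Rightarrow> 'a \<Rightarrow> 'a \<Rightarrow> int" and Hs :: "'i \<Rightarrow> 'a set"
    and H :: "('h, 'n) monoid_scheme" and d :: "'h \<Rightarrow> 'h \<Rightarrow> 'h \<Rightarrow> int"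
    and \<phi> :: "'i \<Rightarrow> 'h \<Rightarrow> 'a" and tag_cmp :: "'i option \<Rightarrow> 'i option \<Rightarrow> int" +
  assumes factor: "i \<in> I \<Longrightarrow> circular_factor (G i) (c i) (Hs i) H d (\<phi> i)"
    and tag_cmp: "comparison_on UNIV tag_cmp"
    and nonempty: "I \<noteq> {}"
begin

abbreviation rep :: "'i \<Rightarrow> 'a \<Rightarrow> 'a" where
  "rep i \<equiv> circular_factor.rep (G i) (Hs i)"

abbreviation rest :: "'i \<Rightarrow> 'a \<Rightarrow> 'h" where
  "rest i \<equiv> circular_factor.rest (G i) (Hs i) H (\<phi> i)"

lemma G_group: "i \<in> I \<Longrightarrow> group (G i)"
  using factor by (simp add: circular_factor_def)

lemmas G_mult_closed [simp] = monoid.m_closed[OF group.is_monoid[OF G_group]]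
  and G_one_closed [simp] = monoid.one_closed[OF group.is_monoid[OF G_group]]

lemmas rep_closed [simp] = circular_factor.rep_props(1)[OF factor]
  and rep_rep [simp] = circular_factor.rep_rep[OF factor]
  and rep_in_K [simp] = circular_factor.rep_in_K[OF factor]
  and rep_mult_rep [simp] = circular_factor.rep_mult_rep[OF factor]
  and rest_closed [simp] = circular_factor.rest_props(1)[OF factor]
  and rest_mult_rep = circular_factor.rest_mult_rep[OF factor]
  and phi_closed [simp] = circular_factor.phi_closed[OF factor]
  and phi_K [simp] = circular_factor.phi_K[OF factor]

text \<open>
  Reducedness: letters are nontrivial coset representatives and neighbouring letters belong to
  different factors. The parameter is the index of the letter in front, so \<open>valid (Some i)\<close> describes
  the normal forms that do not start with a letter of \<open>G i\<close>.
\<close>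
primrec valid :: "'i option \<Rightarrow> ('i, 'a, 'h) nf \<Rightarrow> bool" where
  "valid p (Leaf h) \<longleftrightarrow> h \<in> carrier H"
| "valid p (Node i s t) \<longleftrightarrow>
     i \<in> I \<and> p \<noteq> Some i \<and> s \<in> carrier (G i) \<and> s \<notin> Hs i \<and> rep i s = s \<and> valid (Some i) t"

lemma valid_iff: "valid p t \<longleftrightarrow> valid None t \<and> (p = None \<or> tag t \<noteq> p)"
  by (cases t) auto

text \<open>
  Left multiplication by an element of \<open>H\<close>: move it to the right past each letter, replacing the
  letter by its new representative.
\<close>
primrec hact :: "'h \<Rightarrow> ('i, 'a, 'h) nf \<Rightarrow> ('i, 'a, 'h) nf" where
  "hact h (Leaf k) = Leaf (h \<otimes>\<^bsub>H\<^esub> k)"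
| "hact h (Node i s t) =
     Node i (rep i (\<phi> i h \<otimes>\<^bsub>G i\<^esub> s)) (hact (rest i (\<phi> i h \<otimes>\<^bsub>G i\<^esub> s)) t)"

lemma tag_hact [simp]: "tag (hact h t) = tag t"
  by (cases t) auto

lemma phi_mult_in_K:
  assumes "i \<in> I" "h \<in> carrier H" "x \<in> carrier (G i)"
  shows "\<phi> i h \<otimes>\<^bsub>G i\<^esub> x \<in> Hs i \<longleftrightarrow> x \<in> Hs i"
proof -
  interpret F: circular_factor "G i" "c i" "Hs i" H d "\<phi> i" using factor[OF assms(1)] .
  have "inv\<^bsub>G i\<^esub> \<phi> i h \<otimes>\<^bsub>G i\<^esub> (\<phi> i h \<otimes>\<^bsub>G i\<^esub> x) = x"
    using assms by (simp add: F.inv_cancel_left)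
  then show ?thesis
    using subgroup.m_closed[OF F.K_subgroup, of "\<phi> i h" x] F.phi_K[OF assms(2)]
      subgroup.m_closed[OF F.K_subgroup, of "inv\<^bsub>G i\<^esub> \<phi> i h" "\<phi> i h \<otimes>\<^bsub>G i\<^esub> x"]
      subgroup.m_inv_closed[OF F.K_subgroup, of "\<phi> i h"] by auto
qed

lemma valid_hact: "h \<in> carrier H \<Longrightarrow> valid p t \<Longrightarrow> valid p (hact h t)"
  by (induction t arbitrary: h p) (auto simp: phi_mult_in_K)

lemma hact_mult:
  "\<lbrakk>h \<in> carrier H; k \<in> carrier H; valid p t\<rbrakk> \<Longrightarrow> hact h (hact k t) = hact (h \<otimes>\<^bsub>H\<^esub> k) t"
proof (induction t arbitrary: h k p)
  case (Leaf a)
  then show ?case by (simp add: H.m_assoc)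
next
  case (Node i s t)
  then have i: "i \<in> I" and s: "s \<in> carrier (G i)" and t: "valid (Some i) t" by auto
  interpret F: circular_factor "G i" "c i" "Hs i" H d "\<phi> i" using factor[OF i] .
  have *: "\<phi> i h \<otimes>\<^bsub>G i\<^esub> (\<phi> i k \<otimes>\<^bsub>G i\<^esub> s) = \<phi> i (h \<otimes>\<^bsub>H\<^esub> k) \<otimes>\<^bsub>G i\<^esub> s"
    using Node s i by (simp add: F.phi_mult F.m_assoc)
  show ?case
    using Node.IH[OF _ _ t] Node.prems i s
      F.rest_mult_rep[of "\<phi> i h" "\<phi> i k \<otimes>\<^bsub>G i\<^esub> s"] by (simp add: *)
qed

lemma hact_one: "valid p t \<Longrightarrow> hact \<one>\<^bsub>H\<^esub> t = t"
proof (induction t arbitrary: p)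
  case (Node i s t)
  then have i: "i \<in> I" by auto
  interpret F: circular_factor "G i" "c i" "Hs i" H d "\<phi> i" using factor[OF i] .
  show ?case using Node by (auto simp: F.phi_one F.rest_one)
qed simp

text \<open>
  Left multiplication of a normal form that does not start in \<open>G i\<close> by an element of \<open>G i\<close>.
  The inverse operation splits a normal form into its leading letter from \<open>G i\<close>, possibly
  trivial, and the remaining trunk. In these coordinates, \<open>G i\<close> acts on the leading letter.
\<close>
definition join :: "'i \<Rightarrow> 'a \<Rightarrow> ('i, 'a, 'h) nf \<Rightarrow> ('i, 'a, 'h) nf" where
  "join i x t =
     (if x \<in> Hs i then hact (rest i x) t else Node i (rep i x) (hact (rest i x) t))"

definition lead :: "'i \<Rightarrow> ('i, 'a, 'h) nf \<Rightarrow> 'a" where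
  "lead i t = (case t of Leaf h \<Rightarrow> \<one>\<^bsub>G i\<^esub> | Node j s w \<Rightarrow> if j = i then s else \<one>\<^bsub>G i\<^esub>)"

definition trunk :: "'i \<Rightarrow> ('i, 'a, 'h) nf \<Rightarrow> ('i, 'a, 'h) nf" where
  "trunk i t = (case t of Leaf h \<Rightarrow> t | Node j s w \<Rightarrow> if j = i then w else t)"

definition act :: "'i \<Rightarrow> 'a \<Rightarrow> ('i, 'a, 'h) nf \<Rightarrow> ('i, 'a, 'h) nf" where
  "act i x t = join i (x \<otimes>\<^bsub>G i\<^esub> lead i t) (trunk i t)"

lemma lead_trunk:
  assumes i: "i \<in> I" and t: "valid None t"
  shows "lead i t \<in> carrier (G i)" "rep i (lead i t) = lead i t" "valid (Some i) (trunk i t)"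
    "join i (lead i t) (trunk i t) = t"
proof -
  interpret F: circular_factor "G i" "c i" "Hs i" H d "\<phi> i" using factor[OF i] .
  have one: "\<one>\<^bsub>G i\<^esub> \<in> Hs i" "rep i \<one>\<^bsub>G i\<^esub> = \<one>\<^bsub>G i\<^esub>"
    using F.rep_one_iff[of "\<one>\<^bsub>G i\<^esub>"] subgroup.one_closed[OF F.K_subgroup] by auto
  show "lead i t \<in> carrier (G i)" and r: "rep i (lead i t) = lead i t"
    and v: "valid (Some i) (trunk i t)"
    using t i one by (auto simp: lead_def trunk_def split: nf.splits)
  show "join i (lead i t) (trunk i t) = t"
  proof (cases "tag t = Some i")
    case True
    then obtain s w where "t = Node i s w" by (cases t) auto
    then show ?thesis using t by (auto simp: join_def lead_def trunk_def F.rest_one hact_one)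
  next
    case False
    then have "lead i t = \<one>\<^bsub>G i\<^esub>" "trunk i t = t"
      by (auto simp: lead_def trunk_def split: nf.splits)
    then show ?thesis using t one by (simp add: join_def F.rest_one hact_one)
  qed
qed

lemma not_tagged:
  assumes "tag t \<noteq> Some i"
  shows "lead i t = \<one>\<^bsub>G i\<^esub>" "trunk i t = t"
  using assms by (auto simp: lead_def trunk_def split: nf.splits)

lemma join_props:
  assumes i: "i \<in> I" and x: "x \<in> carrier (G i)" and t: "valid (Some i) t"
  shows "valid None (join i x t)" "lead i (join i x t) = rep i x"
    "trunk i (join i x t) = hact (rest i x) t"
proof -
  interpret F: circular_factor "G i" "c i" "Hs i" H d "\<phi> i" using factor[OF i] .
  have "valid (Some i) (hact (rest i x) t)" using valid_hact i x t by simp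
  then show "valid None (join i x t)"
    using i x by (auto simp: join_def valid_iff[of "Some i"])
  have tg: "tag (hact (rest i x) t) \<noteq> Some i"
    using t valid_iff[of "Some i" t] by simp
  show "lead i (join i x t) = rep i x" "trunk i (join i x t) = hact (rest i x) t"
    using F.rep_one_iff[OF x] not_tagged[OF tg] by (auto simp: join_def lead_def trunk_def)
qed

text \<open>
  Normal forms carry actions of the groups \<open>G i\<close>, because splitting off the rest first and multiplying
  afterwards gives the same representative and the same rest. The lemmas that follow conclude that
  these actions satisfy the defining relations of the amalgam.
\<close>
lemma act_join:
  assumes "i \<in> I" "x \<in> carrier (G i)" "y \<in> carrier (G i)" "valid (Some i) t"
  shows "act i x (join i y t) = join i (x \<otimes>\<^bsub>G i\<^esub> y) t"
proof -
  interpret F: circular_factor "G i" "c i" "Hs i" H d "\<phi> i" using factor[OF assms(1)] .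
  have "x \<otimes>\<^bsub>G i\<^esub> rep i y \<in> Hs i \<longleftrightarrow> x \<otimes>\<^bsub>G i\<^esub> y \<in> Hs i"
    using F.rep_one_iff[of "x \<otimes>\<^bsub>G i\<^esub> rep i y"] F.rep_one_iff[of "x \<otimes>\<^bsub>G i\<^esub> y"] assms by simp
  then show ?thesis
    using assms join_props F.rest_mult_rep[of x y]
    by (simp add: act_def join_def[of _ "x \<otimes>\<^bsub>G i\<^esub> rep i y"] join_def[of _ "x \<otimes>\<^bsub>G i\<^esub> y"]
        hact_mult[of _ _ "Some i"])
qed

lemma act_valid: "\<lbrakk>i \<in> I; x \<in> carrier (G i); valid None t\<rbrakk> \<Longrightarrow> valid None (act i x t)"
  using lead_trunk join_props by (simp add: act_def)

lemma act_mult: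
  assumes "i \<in> I" "x \<in> carrier (G i)" "y \<in> carrier (G i)" "valid None t"
  shows "act i x (act i y t) = act i (x \<otimes>\<^bsub>G i\<^esub> y) t"
  using act_join[of i x "y \<otimes>\<^bsub>G i\<^esub> lead i t" "trunk i t"] lead_trunk[OF assms(1,4)] assms
    monoid.m_assoc[OF group.is_monoid[OF G_group]]
  by (simp add: act_def[of i y] act_def[of i "x \<otimes>\<^bsub>G i\<^esub> y"])

lemma act_one: "\<lbrakk>i \<in> I; valid None t\<rbrakk> \<Longrightarrow> act i \<one>\<^bsub>G i\<^esub> t = t"
  using lead_trunk[of i t] monoid.l_one[OF group.is_monoid[OF G_group]] by (simp add: act_def)

lemma hact_join:
  assumes "i \<in> I" "h \<in> carrier H" "y \<in> carrier (G i)" "valid (Some i) t"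
  shows "hact h (join i y t) = join i (\<phi> i h \<otimes>\<^bsub>G i\<^esub> y) t"
proof -
  interpret F: circular_factor "G i" "c i" "Hs i" H d "\<phi> i" using factor[OF assms(1)] .
  show ?thesis
  proof (cases "y \<in> Hs i")
    case True
    then have "rest i (\<phi> i h \<otimes>\<^bsub>G i\<^esub> y) = h \<otimes>\<^bsub>H\<^esub> rest i y"
      using F.rest_mult_rep[of "\<phi> i h" y] F.rep_one_iff[of y] assms by (simp add: F.rest_phi)
    then show ?thesis
      using True assms hact_mult[of h "rest i y" "Some i" t]
      by (simp add: join_def phi_mult_in_K)
  next
    case False
    then show ?thesis
      using assms hact_mult[of "rest i (\<phi> i h \<otimes>\<^bsub>G i\<^esub> rep i y)" "rest i y" "Some i" t]
        F.rest_mult_rep[of "\<phi> i h" y]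
      by (simp add: join_def phi_mult_in_K)
  qed
qed

lemma act_phi:
  assumes "i \<in> I" "h \<in> carrier H" "valid None t"
  shows "act i (\<phi> i h) t = hact h t"
  using hact_join[of i h "lead i t" "trunk i t"] lead_trunk[OF assms(1,3)] assms
  by (simp add: act_def)

section \<open>The ordering of normal forms\<close>

text \<open>
  Think of a normal form as a path from the root of a planar tree to a leaf. At every node the
  neighbours are arranged on a circle: at a coset of \<open>G i\<close> they are the cosets of \<open>Hs i\<close> in it,
  and between two letters they are the index of the preceding letter, the indices of the possible
  next letters and \<open>None\<close>, which stands for the leaf at which the word stops. The parameter \<open>p\<close> is
  the neighbour from which the node was entered (any choice will do at the root); the circle is cut
  there and becomes a line. Normal forms are compared at the first place where they differ, and in
  the linear order of \<open>H\<close> if all letters agree.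
\<close>
primrec cmp :: "'i option \<Rightarrow> ('i, 'a, 'h) nf \<Rightarrow> ('i, 'a, 'h) nf \<Rightarrow> int" where
  "cmp p (Leaf a) v = (case v of
      Leaf b \<Rightarrow> sign_cmp H d a b
    | Node j r w \<Rightarrow> cut_after tag_cmp p None (Some j))"
| "cmp p (Node i s t) v = (case v of
      Leaf b \<Rightarrow> cut_after tag_cmp p (Some i) None
    | Node j r w \<Rightarrow>
        if i \<noteq> j then cut_after tag_cmp p (Some i) (Some j)
        else if s \<noteq> r then c i \<one>\<^bsub>G i\<^esub> s r
        else cmp (Some i) t w)"

lemma cmp_tags: "tag u \<noteq> tag v \<Longrightarrow> cmp p u v = cut_after tag_cmp p (tag u) (tag v)"
  by (cases u; cases v) auto

lemma sign_cmp_comparison: "comparison_on (carrier H) (sign_cmp H d)"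
  using nonempty circular_factor.sign_cmp_comparison[OF factor] by blast

lemma node_cmp_comparison:
  assumes "i \<in> I"
  shows "comparison_on (carrier (G i) - Hs i) (c i \<one>\<^bsub>G i\<^esub>)"
proof -
  interpret F: circular_factor "G i" "c i" "Hs i" H d "\<phi> i" using factor[OF assms] .
  have "carrier (G i) - Hs i \<subseteq> carrier (G i) - {\<one>\<^bsub>G i\<^esub>}"
    using subgroup.one_closed[OF F.K_subgroup] by blast
  then show ?thesis
    using comparison_on_subset F.cut_at_comparison[OF F.one_closed] by blast
qed

lemma cut_anti: "cut_after tag_cmp p b a = - cut_after tag_cmp p a b"
  using comparison_onD(3)[OF cut_after_comparison[OF tag_cmp]] by blast

lemma cut_trans:
  "cut_after tag_cmp p a b = 1 \<Longrightarrow> cut_after tag_cmp p b e = 1 \<Longrightarrow> cut_after tag_cmp p a e = 1"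
  using comparison_onD(4)[OF cut_after_comparison[OF tag_cmp]] by blast

lemma cmp_basic:
  "valid p u \<Longrightarrow> valid p v \<Longrightarrow>
     cmp p u v \<in> {-1, 0, 1} \<and> (cmp p u v = 0 \<longleftrightarrow> u = v) \<and> cmp p v u = - cmp p u v"
proof (induction u arbitrary: p v)
  case (Leaf a)
  then show ?case
  proof (cases v)
    case (Leaf b)
    then show ?thesis using Leaf.prems \<open>v = Leaf b\<close>
        comparison_onD(1-3)[OF sign_cmp_comparison, of a b] by simp
  next
    case (Node j r w)
    then show ?thesis
      using comparison_onD(1-3)[OF cut_after_comparison[OF tag_cmp], of None "Some j" p] by simp
  qed
next
  case (Node i s t)
  show ?case
  proof (cases "tag v = Some i")
    case False
    then show ?thesis
      using cmp_tags[of "Node i s t" v] cmp_tags[of v "Node i s t"]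
      comparison_onD(1-3)[OF cut_after_comparison[OF tag_cmp], of "Some i" "tag v" p] by auto
  next
    case True
    then obtain r w where v: "v = Node i r w" by (cases v) auto
    show ?thesis
      using Node.prems v Node.IH[of "Some i" w]
        comparison_onD(1-3)[OF node_cmp_comparison, of i s r]
      by (cases "s = r") auto
  qed
qed

text \<open>
  The order is lexicographic: at the first place where two normal forms differ they are compared by a
  linear order of the neighbours, and these orders are transitive.
\<close>
lemma cmp_trans:
  "\<lbrakk>valid p u; valid p v; valid p w; cmp p u v = 1; cmp p v w = 1\<rbrakk> \<Longrightarrow> cmp p u w = 1"
proof (induction u arbitrary: p v w)
  case (Leaf a)
  show ?case
  proof (cases "tag v = None \<and> tag w = None")
    case True
    then obtain b e where "v = Leaf b" "w = Leaf e" by (cases v; cases w) auto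
    then show ?thesis
      using Leaf comparison_onD(4)[OF sign_cmp_comparison, of a b e] by simp
  next
    case False
    show ?thesis
      using Leaf.prems(4,5) cut_anti[of p "tag v" None] cut_trans[of p None "tag v" "tag w"] False
        cmp_tags[of "Leaf a" v p] cmp_tags[of v w p] cmp_tags[of "Leaf a" w p]
      by (cases "tag v = None"; cases "tag w = None"; cases "tag v = tag w") auto
  qed
next
  case (Node i s t)
  show ?case
  proof (cases "tag v = Some i \<and> tag w = Some i")
    case True
    then obtain r x q y where vw: "v = Node i r x" "w = Node i q y" by (cases v; cases w) auto
    have i: "i \<in> I" and elems: "s \<in> carrier (G i) - Hs i" "r \<in> carrier (G i) - Hs i"
        "q \<in> carrier (G i) - Hs i" and xy: "valid (Some i) t" "valid (Some i) x" "valid (Some i) y"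
      using Node.prems(1-3) vw by auto
    note D = comparison_onD(3-4)[OF node_cmp_comparison[OF i]]
    have less: "cmp p (Node i s t) (Node i r x) = 1" "cmp p (Node i r x) (Node i q y) = 1"
      using Node.prems(4,5) vw by auto
    consider "s = r" "r = q" | "s = r" "r \<noteq> q" | "s \<noteq> r" "r = q" | "s \<noteq> r" "r \<noteq> q" by blast
    then show ?thesis
    proof cases
      case 1
      then show ?thesis using Node.IH[OF xy] less vw by simp
    next
      case 4
      then have "c i \<one>\<^bsub>G i\<^esub> s r = 1" "c i \<one>\<^bsub>G i\<^esub> r q = 1" using less by simp_all
      then show ?thesis
        using D(1)[OF elems(1,2)] D(2)[OF elems(1,2,3)] vw by auto
    qed (use less vw in simp_all)
  next
    case False
    show ?thesis
      using Node.prems(4,5) cut_anti[of p "tag v" "Some i"] cut_trans[of p "Some i" "tag v" "tag w"] False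
        cmp_tags[of "Node i s t" v p] cmp_tags[of v w p] cmp_tags[of "Node i s t" w p]
      by (cases "tag v = Some i"; cases "tag w = Some i"; cases "tag v = tag w") auto
  qed
qed

lemma cmp_comparison: "comparison_on (Collect (valid p)) (cmp p)"
  unfolding comparison_on_def using cmp_basic cmp_trans by blast

lemma cmp_recut:
  "cmp q u v = cmp p u v + (offset tag_cmp q (tag u) - offset tag_cmp p (tag u))
                         - (offset tag_cmp q (tag v) - offset tag_cmp p (tag v))"
  by (cases u; cases v) (auto simp: cut_after_def)

text \<open>
  Changing the point of view at the root only cuts the same circle elsewhere.
\<close>
lemma cyclic_cmp_root: "cyclic (cmp q) u v w = cyclic (cmp p) u v w"
  using cmp_recut[of q u v p] cmp_recut[of q v w p] cmp_recut[of q w u p] by (simp add: cyclic_def)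

text \<open>
  An element of \<open>H\<close> preserves the index of every letter and fixes the coset \<open>Hs i\<close> from which each
  circle \<open>G i / Hs i\<close> is entered; hence it preserves all the lines obtained by cutting there.
\<close>
lemma cmp_hact:
  "\<lbrakk>h \<in> carrier H; valid p u; valid p v\<rbrakk> \<Longrightarrow> cmp p (hact h u) (hact h v) = cmp p u v"
proof (induction u arbitrary: h p v)
  case (Leaf a)
  then show ?case by (cases v) (auto simp: H.sign_cmp_left_mult)
next
  case (Node i s t)
  show ?case
  proof (cases "tag v = Some i")
    case False
    then show ?thesis by (cases v) auto
  next
    case True
    then obtain r w where v: "v = Node i r w" by (cases v) auto
    then have i: "i \<in> I" and sr: "s \<in> carrier (G i)" "r \<in> carrier (G i)" "s \<notin> Hs i" "r \<notin> Hs i"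
      "rep i s = s" "rep i r = r" and tw: "valid (Some i) t" "valid (Some i) w"
      using Node.prems by auto
    interpret F: circular_factor "G i" "c i" "Hs i" H d "\<phi> i" using factor[OF i] .
    show ?thesis
    proof (cases "s = r")
      case True
      then show ?thesis
        using Node.IH[OF _ tw] i sr Node.prems v by simp
    next
      case False
      let ?s = "\<phi> i h \<otimes>\<^bsub>G i\<^esub> s" and ?r = "\<phi> i h \<otimes>\<^bsub>G i\<^esub> r"
      have h: "h \<in> carrier H" using Node.prems by simp
      have cl: "?s \<in> carrier (G i)" "?r \<in> carrier (G i)" "\<phi> i h \<in> carrier (G i)" using sr h i by auto
      have ns: "\<not> F.same s r" using False F.rep_eq_iff[of s r] sr by simp
      then have ne: "rep i ?s \<noteq> rep i ?r"
        using F.rep_eq_iff[OF cl(1,2)] F.same_left[of "\<phi> i h" s r] sr cl by simp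
      have one: "F.same (\<phi> i h \<otimes>\<^bsub>G i\<^esub> \<one>\<^bsub>G i\<^esub>) \<one>\<^bsub>G i\<^esub>"
        using F.same_one[of "\<phi> i h"] F.same_sym[of "\<one>\<^bsub>G i\<^esub>" "\<phi> i h"] F.phi_K h cl by simp
      have b: "F.between \<one>\<^bsub>G i\<^esub> x y = c i \<one>\<^bsub>G i\<^esub> x y"
        if "x \<in> carrier (G i)" "y \<in> carrier (G i)" "x \<notin> Hs i" "y \<notin> Hs i" "\<not> F.same x y" for x y
        using that F.same_one unfolding F.between_def by simp
      have nsr: "\<not> F.same (rep i ?s) (rep i ?r)"
        using ne F.rep_eq_iff[of "rep i ?s" "rep i ?r"] cl i by simp
      have "c i \<one>\<^bsub>G i\<^esub> (rep i ?s) (rep i ?r) = F.between \<one>\<^bsub>G i\<^esub> (rep i ?s) (rep i ?r)"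
        using b[of "rep i ?s" "rep i ?r"] nsr cl i sr h by (simp add: phi_mult_in_K)
      also have "\<dots> = F.between \<one>\<^bsub>G i\<^esub> ?s ?r"
        using F.between_cong2[of "\<one>\<^bsub>G i\<^esub>" "rep i ?s" ?s "rep i ?r"]
          F.between_cong3[of "\<one>\<^bsub>G i\<^esub>" ?s "rep i ?r" ?r] cl i F.rep_props by simp
      also have "\<dots> = F.between (\<phi> i h \<otimes>\<^bsub>G i\<^esub> \<one>\<^bsub>G i\<^esub>) ?s ?r"
        using F.between_cong1[OF _ _ cl(1,2) one] cl by simp
      also have "\<dots> = F.between \<one>\<^bsub>G i\<^esub> s r"
        using F.between_left[of "\<phi> i h" "\<one>\<^bsub>G i\<^esub>" s r] cl sr by simp
      also have "\<dots> = c i \<one>\<^bsub>G i\<^esub> s r" using b sr ns by simp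
      finally show ?thesis using ne False v by simp
    qed
  qed
qed

text \<open>
  Seen from the factor \<open>G i\<close>, normal forms are ordered lexicographically by the coset of the leading
  letter, cut before \<open>Hs i\<close>, and then by the trunk. Trunks come first among all normal forms because
  \<open>cut_after\<close> makes the index \<open>i\<close> the last one.
\<close>
lemma cmp_join:
  assumes i: "i \<in> I" and yz: "y \<in> carrier (G i)" "z \<in> carrier (G i)"
    and uv: "valid (Some i) u" "valid (Some i) v"
  shows "cmp (Some i) (join i y u) (join i z v) =
    circular_factor.coset_cmp (G i) (c i) (Hs i) \<one>\<^bsub>G i\<^esub> y z +
    (if rep i y = rep i z then cmp (Some i) (hact (rest i y) u) (hact (rest i z) v) else 0)"
proof -
  interpret F: circular_factor "G i" "c i" "Hs i" H d "\<phi> i" using factor[OF i] .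
  have tags: "tag u \<noteq> Some i" "tag v \<noteq> Some i"
    using uv valid_iff[of "Some i"] by auto
  note last = cut_after_last[OF tag_cmp]
  show ?thesis
  proof (cases "F.same y z")
    case True
    then have "rep i y = rep i z" "y \<in> Hs i \<longleftrightarrow> z \<in> Hs i"
      using F.rep_eq_iff[OF yz] F.same_K[OF yz] by auto
    moreover have "F.coset_cmp \<one>\<^bsub>G i\<^esub> y z = 0"
      using True F.between_degenerate[of "\<one>\<^bsub>G i\<^esub>" y z] calculation F.same_one yz
      by (simp add: F.coset_cmp_def)
    ultimately show ?thesis by (simp add: join_def)
  next
    case False
    then have ne: "rep i y \<noteq> rep i z" using F.rep_eq_iff[OF yz] by auto
    have K: "F.same \<one>\<^bsub>G i\<^esub> y \<longleftrightarrow> y \<in> Hs i" "F.same \<one>\<^bsub>G i\<^esub> z \<longleftrightarrow> z \<in> Hs i"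
      using F.same_one yz by auto
    consider "y \<in> Hs i" "z \<in> Hs i" | "y \<in> Hs i" "z \<notin> Hs i" | "y \<notin> Hs i" "z \<in> Hs i"
      | "y \<notin> Hs i" "z \<notin> Hs i" by blast
    then show ?thesis
    proof cases
      case 1
      then show ?thesis using F.rep_one_iff[OF yz(1)] F.rep_one_iff[OF yz(2)] ne by simp
    next
      case 2
      then show ?thesis
        using ne K last[of "tag u" "Some i"] cmp_tags[of "hact (rest i y) u" "join i z v"] tags
        by (simp add: join_def F.coset_cmp_def F.between_degenerate)
    next
      case 3
      then show ?thesis
        using ne K last[of "tag v" "Some i"] cut_anti[of "Some i" "Some i" "tag v"]
          cmp_tags[of "join i y u" "hact (rest i z) v"] tags
        by (simp add: join_def F.coset_cmp_def F.between_degenerate)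
    next
      case 4
      have nsr: "\<not> F.same (rep i y) (rep i z)"
        using ne F.rep_eq_iff[of "rep i y" "rep i z"] yz i by simp
      have "F.between \<one>\<^bsub>G i\<^esub> y z = F.between \<one>\<^bsub>G i\<^esub> (rep i y) (rep i z)"
        using F.between_cong2[of "\<one>\<^bsub>G i\<^esub>" y "rep i y" z]
          F.between_cong3[of "\<one>\<^bsub>G i\<^esub>" "rep i y" z "rep i z"] yz i F.rep_props by simp
      also have "\<dots> = c i \<one>\<^bsub>G i\<^esub> (rep i y) (rep i z)"
        using nsr 4 yz i F.same_one by (simp add: F.between_def)
      finally show ?thesis using 4 ne K by (simp add: join_def F.coset_cmp_def)
    qed
  qed
qed

text \<open>
  It is best to look from the index \<open>i\<close> of the acting group, by \<open>cyclic_cmp_root\<close>. In the description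
  of \<open>cmp_join\<close>, multiplication by \<open>x\<close> moves the cut of the circle of cosets to \<open>inv x\<close>, which is a
  coboundary, and acts on trunks through \<open>H\<close>, which preserves their order.
\<close>
lemma cyclic_act:
  assumes i: "i \<in> I" and x: "x \<in> carrier (G i)"
    and "valid None u" "valid None v" "valid None w"
  shows "cyclic (cmp p) (act i x u) (act i x v) (act i x w) = cyclic (cmp p) u v w"
proof -
  interpret F: circular_factor "G i" "c i" "Hs i" H d "\<phi> i" using factor[OF i] .
  have "cmp (Some i) (act i x a) (act i x b) = cmp (Some i) a b
      + F.recut \<one>\<^bsub>G i\<^esub> (inv\<^bsub>G i\<^esub> x) (lead i a) - F.recut \<one>\<^bsub>G i\<^esub> (inv\<^bsub>G i\<^esub> x) (lead i b)"
    if ab: "a \<in> Collect (valid None)" "b \<in> Collect (valid None)" for a b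
  proof -
    let ?s = "lead i a" and ?r = "lead i b" and ?a = "trunk i a" and ?b = "trunk i b"
    have a: "?s \<in> carrier (G i)" "rep i ?s = ?s" "valid (Some i) ?a" "a = join i ?s ?a"
      and b: "?r \<in> carrier (G i)" "rep i ?r = ?r" "valid (Some i) ?b" "b = join i ?r ?b"
      using lead_trunk[OF i] ab by auto
    have rep: "rep i (x \<otimes>\<^bsub>G i\<^esub> ?s) = rep i (x \<otimes>\<^bsub>G i\<^esub> ?r) \<longleftrightarrow> ?s = ?r"
      using F.rep_eq_iff[of "x \<otimes>\<^bsub>G i\<^esub> ?s" "x \<otimes>\<^bsub>G i\<^esub> ?r"] F.rep_eq_iff[of ?s ?r]
        F.same_left[of x ?s ?r] a(1,2) b(1,2) x by simp
    have fib: "cmp (Some i) (hact k ?a) (hact k ?b) = cmp (Some i) ?a ?b" if "k \<in> carrier H" for k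
      using cmp_hact that a(3) b(3) by simp
    have "F.coset_cmp \<one>\<^bsub>G i\<^esub> (x \<otimes>\<^bsub>G i\<^esub> ?s) (x \<otimes>\<^bsub>G i\<^esub> ?r) = F.coset_cmp (inv\<^bsub>G i\<^esub> x) ?s ?r"
      using F.coset_cmp_left[of x "inv\<^bsub>G i\<^esub> x" ?s ?r] a(1) b(1) x by simp
    also have "\<dots> = F.coset_cmp \<one>\<^bsub>G i\<^esub> ?s ?r
        + F.recut \<one>\<^bsub>G i\<^esub> (inv\<^bsub>G i\<^esub> x) ?s - F.recut \<one>\<^bsub>G i\<^esub> (inv\<^bsub>G i\<^esub> x) ?r"
      using F.coset_cmp_recut[of "\<one>\<^bsub>G i\<^esub>" "inv\<^bsub>G i\<^esub> x" ?s ?r] a(1) b(1) x by simp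
    finally have base: "F.coset_cmp \<one>\<^bsub>G i\<^esub> (x \<otimes>\<^bsub>G i\<^esub> ?s) (x \<otimes>\<^bsub>G i\<^esub> ?r) = \<dots>" .
    have "cmp (Some i) (act i x a) (act i x b) =
        F.coset_cmp \<one>\<^bsub>G i\<^esub> (x \<otimes>\<^bsub>G i\<^esub> ?s) (x \<otimes>\<^bsub>G i\<^esub> ?r) +
        (if ?s = ?r then cmp (Some i) ?a ?b else 0)"
      using cmp_join[OF i _ _ a(3) b(3), of "x \<otimes>\<^bsub>G i\<^esub> ?s" "x \<otimes>\<^bsub>G i\<^esub> ?r"] a(1) b(1) x i rep fib
      by (auto simp: act_def)
    moreover have "cmp (Some i) a b =
        F.coset_cmp \<one>\<^bsub>G i\<^esub> ?s ?r + (if ?s = ?r then cmp (Some i) ?a ?b else 0)"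
      using cmp_join[OF i a(1) b(1) a(3) b(3)] a(1,2) b(1,2) i fib
      unfolding a(4)[symmetric] b(4)[symmetric] by auto
    ultimately show ?thesis using base by simp
  qed
  then have "cyclic (cmp (Some i)) (act i x u) (act i x v) (act i x w) = cyclic (cmp (Some i)) u v w"
    using assms(3-5) by (simp add: cyclic_def)
  then show ?thesis
    using cyclic_cmp_root[of p _ _ _ "Some i"] by simp
qed

abbreviation base :: "('i, 'a, 'h) nf" where
  "base \<equiv> Leaf \<one>\<^bsub>H\<^esub>"

text \<open>
  The orbit of \<open>base\<close> under \<open>G i\<close> consists of the words with at most one letter, from \<open>G i\<close>; by \<open>cmp_join\<close>
  their order is the cosets-then-fibres order that describes \<open>c i\<close>.
\<close>
lemma cyclic_base:
  assumes i: "i \<in> I" and xyz: "x \<in> carrier (G i)" "y \<in> carrier (G i)" "z \<in> carrier (G i)"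
  shows "cyclic (cmp p) (act i x base) (act i y base) (act i z base) = c i x y z"
proof -
  interpret F: circular_factor "G i" "c i" "Hs i" H d "\<phi> i" using factor[OF i] .
  have act: "act i a base = join i a base" if "a \<in> carrier (G i)" for a
    using that by (simp add: act_def lead_def trunk_def)
  have "cmp (Some i) (act i a base) (act i b base) = F.coset_cmp \<one>\<^bsub>G i\<^esub> a b + F.fiber_cmp a b"
    if "a \<in> carrier (G i)" "b \<in> carrier (G i)" for a b
    using that i cmp_join[OF i that, of base base] F.rep_eq_iff[OF that] F.fiber_cmp_rest[OF that]
    by (auto simp: act F.fiber_cmp_def)
  then have "cyclic (cmp (Some i)) (act i x base) (act i y base) (act i z base) =
      cyclic (\<lambda>a b. F.coset_cmp \<one>\<^bsub>G i\<^esub> a b + F.fiber_cmp a b) x y z"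
    using xyz by (simp add: cyclic_def)
  also have "\<dots> = c i x y z"
    using F.c_eq_cyclic[of x y z "\<one>\<^bsub>G i\<^esub>"] xyz by simp
  finally show ?thesis using cyclic_cmp_root[of p _ _ _ "Some i"] by simp
qed

section \<open>The amalgam as an orbit of normal forms\<close>

sublocale A: amalgam_data I G H \<phi>
  by (rule amalgam_data.intro) (simp_all add: G_group)

sublocale P: group A.P
  by (rule A.group_P)

lemma inj_mult:
  "\<lbrakk>i \<in> I; x \<in> carrier (G i); y \<in> carrier (G i)\<rbrakk> \<Longrightarrow>
    A.\<iota> i (x \<otimes>\<^bsub>G i\<^esub> y) = A.\<iota> i x \<otimes>\<^bsub>A.P\<^esub> A.\<iota> i y"
  using A.inj_hom by (auto simp: hom_def)

definition some_index :: 'i where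
  "some_index = (SOME i. i \<in> I)"

lemma some_index [simp]: "some_index \<in> I"
  unfolding some_index_def using nonempty by (simp add: some_in_eq)

text \<open>
  The element of the amalgam that a normal form denotes. The choice of the factor in which a leaf is
  read is immaterial, since the images of \<open>H\<close> in all factors are identified.
\<close>
primrec realize :: "('i, 'a, 'h) nf \<Rightarrow> ('i \<times> 'a) list set" where
  "realize (Leaf h) = A.\<iota> some_index (\<phi> some_index h)"
| "realize (Node i s t) = A.\<iota> i s \<otimes>\<^bsub>A.P\<^esub> realize t"

lemma realize_closed: "valid p t \<Longrightarrow> realize t \<in> carrier A.P"
  by (induction t arbitrary: p) (auto simp: A.inj_closed)

lemma realize_base: "realize base = \<one>\<^bsub>A.P\<^esub>"
proof -
  interpret F: circular_factor "G some_index" "c some_index" "Hs some_index" H d "\<phi> some_index"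
    using factor by simp
  show ?thesis
    using hom_one[OF A.inj_hom[OF some_index] F.is_group P.is_group] by (simp add: F.phi_one)
qed

text \<open>
  This is the step \<open>x = rep x * rest x\<close> of the normalisation, carried out in the amalgam.
\<close>
lemma realize_split:
  assumes "i \<in> I" "x \<in> carrier (G i)" "B \<in> carrier A.P"
  shows "A.\<iota> i x \<otimes>\<^bsub>A.P\<^esub> B = A.\<iota> i (rep i x) \<otimes>\<^bsub>A.P\<^esub> (A.\<iota> i (\<phi> i (rest i x)) \<otimes>\<^bsub>A.P\<^esub> B)"
proof -
  interpret F: circular_factor "G i" "c i" "Hs i" H d "\<phi> i" using factor[OF assms(1)] .
  have "A.\<iota> i x = A.\<iota> i (rep i x) \<otimes>\<^bsub>A.P\<^esub> A.\<iota> i (\<phi> i (rest i x))"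
    using inj_mult[of i "rep i x" "\<phi> i (rest i x)"] F.rest_props(3)[of x] assms by simp
  then show ?thesis using assms by (simp add: P.m_assoc A.inj_closed)
qed

lemma realize_hact:
  "\<lbrakk>i \<in> I; h \<in> carrier H; valid p t\<rbrakk> \<Longrightarrow> A.\<iota> i (\<phi> i h) \<otimes>\<^bsub>A.P\<^esub> realize t = realize (hact h t)"
proof (induction t arbitrary: i h p)
  case (Leaf a)
  interpret F: circular_factor "G some_index" "c some_index" "Hs some_index" H d "\<phi> some_index"
    using factor by simp
  show ?case
    using Leaf A.inj_identify[of i some_index h] by (simp add: F.phi_mult inj_mult)
next
  case (Node j s t)
  then have j: "j \<in> I" and s: "s \<in> carrier (G j)" and t: "valid (Some j) t" by auto
  let ?y = "\<phi> j h \<otimes>\<^bsub>G j\<^esub> s"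
  have "A.\<iota> i (\<phi> i h) \<otimes>\<^bsub>A.P\<^esub> realize (Node j s t) = A.\<iota> j ?y \<otimes>\<^bsub>A.P\<^esub> realize t"
    using A.inj_identify[of i j h] Node.prems j s realize_closed[OF t]
    by (simp add: inj_mult P.m_assoc A.inj_closed)
  then show ?case
    using realize_split[OF j, of ?y "realize t"] Node.IH[OF j _ t] Node.prems j s realize_closed[OF t]
    by simp
qed

lemma realize_join:
  assumes "i \<in> I" "x \<in> carrier (G i)" "valid (Some i) t"
  shows "A.\<iota> i x \<otimes>\<^bsub>A.P\<^esub> realize t = realize (join i x t)"
proof -
  interpret F: circular_factor "G i" "c i" "Hs i" H d "\<phi> i" using factor[OF assms(1)] .
  have 1: "A.\<iota> i x \<otimes>\<^bsub>A.P\<^esub> realize t = A.\<iota> i (rep i x) \<otimes>\<^bsub>A.P\<^esub> realize (hact (rest i x) t)"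
    using realize_split[of i x "realize t"] realize_hact[of i "rest i x" "Some i" t]
      realize_closed[OF assms(3)] assms by simp
  show ?thesis
  proof (cases "x \<in> Hs i")
    case True
    then have "rep i x = \<one>\<^bsub>G i\<^esub>" using F.rep_one_iff assms(2) by simp
    moreover have "A.\<iota> i \<one>\<^bsub>G i\<^esub> = \<one>\<^bsub>A.P\<^esub>"
      using hom_one[OF A.inj_hom[OF assms(1)] F.is_group P.is_group] .
    moreover have "realize (hact (rest i x) t) \<in> carrier A.P"
      using realize_closed valid_hact assms rest_closed by meson
    ultimately show ?thesis using 1 True by (simp add: join_def)
  next
    case False
    then show ?thesis using 1 by (simp add: join_def)
  qed
qed

lemma realize_act:
  assumes "i \<in> I" "x \<in> carrier (G i)" "valid None t"
  shows "A.\<iota> i x \<otimes>\<^bsub>A.P\<^esub> realize t = realize (act i x t)"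
proof -
  note lt = lead_trunk[OF assms(1,3)]
  have "realize t = A.\<iota> i (lead i t) \<otimes>\<^bsub>A.P\<^esub> realize (trunk i t)"
    using realize_join[OF assms(1) lt(1,3)] lt(4) by simp
  then show ?thesis
    using realize_join[OF assms(1) _ lt(3), of "x \<otimes>\<^bsub>G i\<^esub> lead i t"] lt(1) assms(1,2) realize_closed[OF lt(3)]
    by (simp add: act_def inj_mult P.m_assoc A.inj_closed)
qed

definition acts :: "('i \<times> 'a) list \<Rightarrow> ('i, 'a, 'h) nf \<Rightarrow> ('i, 'a, 'h) nf" where
  "acts u t = foldr (\<lambda>(i, x). act i x) u t"

lemma acts_simps [simp]:
  "acts [] t = t" "acts ((i, x) # u) t = act i x (acts u t)" "acts (u @ v) t = acts u (acts v t)"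
  by (simp_all add: acts_def)

lemma acts_valid: "u \<in> A.W \<Longrightarrow> valid None t \<Longrightarrow> valid None (acts u t)"
  by (induction u) (auto simp: act_valid)

lemma acts_eq:
  "amalgam_eq I G H \<phi> u v \<Longrightarrow> valid None t \<Longrightarrow> acts u t = acts v t"
proof (induction arbitrary: t rule: amalgam_eq.induct)
  case (mult u v i x y)
  then show ?case by (simp add: act_mult acts_valid)
next
  case (one u v i)
  then show ?case by (simp add: act_one acts_valid)
next
  case (identify u v i j h)
  then show ?case by (simp add: act_phi acts_valid)
qed auto

lemma realize_acts:
  assumes "u \<in> A.W" "valid None t"
  shows "A.R `` {u} \<otimes>\<^bsub>A.P\<^esub> realize t = realize (acts u t)"
  using assms(1)
proof (induction u)
  case Nil
  then show ?case using realize_closed[OF assms(2)] by (simp add: A.one_P[symmetric])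
next
  case (Cons p u)
  obtain i x where p: "p = (i, x)" by (cases p)
  with Cons have i: "i \<in> I" "x \<in> carrier (G i)" "u \<in> A.W" by auto
  have "A.R `` {p # u} = A.\<iota> i x \<otimes>\<^bsub>A.P\<^esub> A.R `` {u}"
    using i by (simp add: p amalgam_inj_def A.mult_P)
  moreover have "A.R `` {u} \<in> carrier A.P" using i by (simp add: A.carrier_P quotientI)
  ultimately show ?case
    using Cons.IH[OF i(3)] realize_act[OF i(1,2) acts_valid[OF i(3) assms(2)]] i(1,2)
      realize_closed[OF assms(2)]
    by (simp add: p P.m_assoc A.inj_closed)
qed

text \<open>
  The image of \<open>base\<close> under an element of the amalgam; by \<open>acts_eq\<close> it depends only on the class of
  the word.
\<close>
definition orbit :: "('i \<times> 'a) list set \<Rightarrow> ('i, 'a, 'h) nf" where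
  "orbit B = acts (SOME u. u \<in> B) base"

lemma valid_base [simp]: "valid p base"
  by simp

lemma orbit_class:
  assumes "u \<in> A.W"
  shows "orbit (A.R `` {u}) = acts u base"
proof -
  have "(SOME v. v \<in> A.R `` {u}) \<in> A.R `` {u}"
    using equiv_class_self[OF A.equiv_R assms] by (rule someI)
  then show ?thesis
    unfolding orbit_def using acts_eq[of u _ base] by (auto simp: amalgam_rel_def)
qed

lemma orbit_valid: "B \<in> carrier A.P \<Longrightarrow> valid None (orbit B)"
  unfolding A.carrier_P by (elim quotientE) (simp add: orbit_class acts_valid)

text \<open>
  The orbit map is injective because \<open>realize\<close> recovers the group element from the image of \<open>base\<close>.
\<close>
lemma orbit_inj:
  assumes "B \<in> carrier A.P" "C \<in> carrier A.P"
  shows "orbit B = orbit C \<longleftrightarrow> B = C"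
proof -
  have "realize (orbit B) = B" if "B \<in> carrier A.P" for B
    using that realize_acts[OF _ valid_base[of None], unfolded realize_base] P.r_one[OF that]
    unfolding A.carrier_P by (elim quotientE) (simp add: orbit_class)
  then show ?thesis using assms by metis
qed

definition amalgam_order where
  "amalgam_order B C D = cyclic (cmp None) (orbit B) (orbit C) (orbit D)"

lemma amalgam_order_left:
  assumes "A \<in> carrier A.P" and BCD: "B \<in> carrier A.P" "C \<in> carrier A.P" "D \<in> carrier A.P"
  shows "amalgam_order (A \<otimes>\<^bsub>A.P\<^esub> B) (A \<otimes>\<^bsub>A.P\<^esub> C) (A \<otimes>\<^bsub>A.P\<^esub> D) = amalgam_order B C D"
proof -
  obtain u where u: "u \<in> A.W" "A = A.R `` {u}"
    using assms(1) unfolding A.carrier_P by (elim quotientE)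
  have orb: "orbit (A \<otimes>\<^bsub>A.P\<^esub> E) = acts u (orbit E)" if "E \<in> carrier A.P" for E
    using that u unfolding A.carrier_P by (elim quotientE) (simp add: A.mult_P orbit_class)
  have "cyclic (cmp None) (acts u a) (acts u b) (acts u e) = cyclic (cmp None) a b e"
    if "valid None a" "valid None b" "valid None e" for a b e
    using u(1) that by (induction u) (auto simp: cyclic_act acts_valid)
  then show ?thesis
    using BCD by (simp add: amalgam_order_def orb orbit_valid)
qed

lemma amalgam_ordered: "circularly_ordered_group A.P amalgam_order"
  unfolding circularly_ordered_group_def circular_ordering_def
proof (intro conjI ballI)
  show "group A.P" by (rule P.is_group)
next
  fix B C D assume B: "B \<in> carrier A.P" "C \<in> carrier A.P" "D \<in> carrier A.P"
  then have v: "orbit B \<in> Collect (valid None)" "orbit C \<in> Collect (valid None)"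
    "orbit D \<in> Collect (valid None)" using orbit_valid by auto
  show "amalgam_order B C D \<in> {-1, 0, 1}"
    unfolding amalgam_order_def using cyclic_values(1)[OF cmp_comparison v] .
  show "amalgam_order B C D = 0 \<longleftrightarrow> (B = C \<or> B = D \<or> C = D)"
    unfolding amalgam_order_def using cyclic_values(2)[OF cmp_comparison v] B orbit_inj by simp
next
  fix B C D E
  assume "B \<in> carrier A.P" "C \<in> carrier A.P" "D \<in> carrier A.P" "E \<in> carrier A.P"
  then show "amalgam_order C D E - amalgam_order B D E + amalgam_order B C E
      - amalgam_order B C D = 0"
    unfolding amalgam_order_def using orbit_valid by (intro cyclic_cocycle[OF cmp_comparison]) auto
qed (rule amalgam_order_left)

lemma orbit_letter:
  assumes "i \<in> I" "x \<in> carrier (G i)"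
  shows "orbit (A.\<iota> i x) = act i x base"
  using assms orbit_class[of "[(i, x)]"] by (simp add: amalgam_inj_def)

lemma amalgam_order_extends:
  assumes "i \<in> I" "x \<in> carrier (G i)" "y \<in> carrier (G i)" "z \<in> carrier (G i)"
  shows "amalgam_order (A.\<iota> i x) (A.\<iota> i y) (A.\<iota> i z) = c i x y z"
  using cyclic_base[OF assms] assms by (simp add: amalgam_order_def orbit_letter)

text \<open>
  The normal form of a single letter \<open>x\<close> determines both \<open>rep x\<close> and \<open>rest x\<close>, hence \<open>x\<close>.
\<close>
lemma amalgam_inj_mon:
  assumes i: "i \<in> I"
  shows "A.\<iota> i \<in> mon (G i) A.P"
proof -
  interpret F: circular_factor "G i" "c i" "Hs i" H d "\<phi> i" using factor[OF i] .
  have "x = y" if xy: "x \<in> carrier (G i)" "y \<in> carrier (G i)" and eq: "A.\<iota> i x = A.\<iota> i y" for x y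
  proof -
    have act: "act i a base = join i a base" if "a \<in> carrier (G i)" for a
      using that by (simp add: act_def lead_def trunk_def)
    have "join i x base = join i y base"
      using eq orbit_letter[OF i] act xy by metis
    then have "rep i x = rep i y" "rest i x = rest i y"
      using join_props(2,3)[OF i xy(1) valid_base] join_props(2,3)[OF i xy(2) valid_base] i xy
      by auto
    then show "x = y" using F.rest_props(3)[OF xy(1)] F.rest_props(3)[OF xy(2)] by metis
  qed
  then show ?thesis using A.inj_hom[OF i] unfolding mon_def inj_on_def by blast
qed

end

theorem proposition1p1:
  fixes I :: "'i set"
    and G :: "'i \<Rightarrow> ('a, 'm) monoid_scheme"
    and c :: "'i \<Rightarrow> 'a \<Rightarrow> 'a \<Rightarrow> 'a \<Rightarrow> int"
    and Hs :: "'i \<Rightarrow> 'a set"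
    and H :: "('h, 'n) monoid_scheme"
    and d :: "'h \<Rightarrow> 'h \<Rightarrow> 'h \<Rightarrow> int"
    and \<phi> :: "'i \<Rightarrow> 'h \<Rightarrow> 'a"
  assumes "\<And>i. i \<in> I \<Longrightarrow> circularly_ordered_group (G i) (c i)"
    and "\<And>i. i \<in> I \<Longrightarrow> convex_subgroup (Hs i) (G i) (c i)"
    and "circularly_ordered_group H d"
    and "\<And>i. i \<in> I \<Longrightarrow> \<phi> i \<in> iso H ((G i)\<lparr>carrier := Hs i\<rparr>)"
    and "\<And>i. i \<in> I \<Longrightarrow> order_preserving H d (c i) (\<phi> i)"
  shows "\<exists>C. circularly_ordered_group (amalgam I G H \<phi>) C \<and>
             (\<forall>i\<in>I. amalgam_inj I G H \<phi> i \<in> mon (G i) (amalgam I G H \<phi>) \<and>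
                    order_preserving (G i) (c i) C (amalgam_inj I G H \<phi> i))"
proof (cases "I = {}")
  case True
  then interpret amalgam_data I G H \<phi> by unfold_locales auto
  have "W = {[]}" using True by (auto simp: amalgam_words_def)
  \<comment> \<open>Without factors the amalgam is trivial.\<close>
  then have "a = b" if "a \<in> carrier P" "b \<in> carrier P" for a b
    using that unfolding carrier_P by (auto elim!: quotientE)
  then have "circularly_ordered_group P (\<lambda>_ _ _. 0)"
    using group_P unfolding circularly_ordered_group_def circular_ordering_def by auto
  then show ?thesis using True by blast
next
  case False
  obtain tag_cmp :: "'i option \<Rightarrow> 'i option \<Rightarrow> int" where tag_cmp: "comparison_on UNIV tag_cmp"
    using ex_comparison by blast
  have grp: "group H" using assms(3) by (simp add: circularly_ordered_group_def)
  interpret circular_amalgam I G c Hs H d \<phi> tag_cmp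
  proof (intro circular_amalgam.intro circular_amalgam_axioms.intro)
    fix i assume "i \<in> I"
    then show "circular_factor (G i) (c i) (Hs i) H d (\<phi> i)"
      using assms grp
      by (intro circular_factor.intro circular_factor_axioms.intro)
        (simp_all add: circularly_ordered_group_def)
  qed (use grp tag_cmp False in auto)
  show ?thesis
    using amalgam_ordered amalgam_order_extends amalgam_inj_mon
    unfolding order_preserving_def by (intro exI[of _ amalgam_order]) simp
qed

end
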